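(* Let $L\colon[a,b]\times\mathbb{R}^n\times\mathbb{R}^n\to\mathbb{R}$ be continuous and satisfy the strict convexity condition (SC) stated in the context. Let $v\in W^{1,1}((a,b);\mathbb{R}^n)$ be a minimizer of $\mathscr{L}$ over $\mathscr{A}_{v(a),v(b)}$, and let $t\in(a,b)$ be such that $D^-v(t)$ and $D^+v(t)$ both exist and each component of both is finite. Then $D^-v(t)=D^+v(t)$.
   Context: $[a,b]\subseteq\mathbb{R}$, $n\ge1$, $\|\cdot\|$ is the Euclidean norm on $\mathbb{R}^n$. Functions in $W^{1,1}((a,b);\mathbb{R}^n)$ are identified with their absolutely continuous representatives on $[a,b]$. $\mathscr{L}(u)=\int_a^bL(t,u(t),u'(t))\,dt$; $\mathscr{A}_{A,B}=\{u\in W^{1,1}((a,b);\mathbb{R}^n):u(a)=A,\ u(b)=B\}$; a minimizer of $\mathscr{L}$ over $\mathscr{A}_{v(a),v(b)}$ is $v$ with $\mathscr{L}(v)\le\mathscr{L}(u)$ for all $u\in\mathscr{A}_{v(a),v(b)}$. Condition (SC): for all $R\in[1,\infty)$ there exists $\tau_R>0$ such that for all $(t,y,p)\in[a,b]\times\mathbb{R}^n\times\mathbb{R}^n$ with $\max\{|t|,\|y\|,\|p\|\}\le R+1$ there exists a subdifferential (subgradient) $\xi\in\mathbb{R}^n$ of $L(t,y,\cdot)$ at $p$ (i.e. $L(t,y,q)\ge L(t,y,p)+\xi\cdot(q-p)$ for all $q\in\mathbb{R}^n$) such that $L(t,y,q)\ge L(t,y,p)+\xi\cdot(q-p)+2\tau_R$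 whenever $\|q-p\|\ge R^{-1}$. One-sided derivatives: for scalar $v$, $D^-v(t)=\lim_{s\uparrow t}\frac{v(s)-v(t)}{s-t}$ and $D^+v(t)=\lim_{s\downarrow t}\frac{v(s)-v(t)}{s-t}$, whenever these limits make sense and exist as finite or infinite values; for vector-valued $v$ they are formed componentwise and exist iff they exist for each component. *)

theory Defs
  imports "HOL-Analysis.Analysis"
begin

text \<open>
  In dimension one, \<open>\<D> division_of S\<close> says that \<open>\<D>\<close> is a finite set of
  non-overlapping compact intervals with union \<open>S\<close>.
\<close>

definition abs_cont_on_interval :: "real \<Rightarrow> real \<Rightarrow> (real \<Rightarrow> 'a::real_normed_vector) \<Rightarrow> bool" where
  "abs_cont_on_interval a b u \<longleftrightarrow>
     (\<forall>\<epsilon>>0. \<exists>\<delta>>0. \<forall>\<D> S. \<D> division_of S \<and> S \<subseteq> {a..b} \<and> (\<Sum>K\<in>\<D>. Sup K - Inf K) < \<delta>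
        \<longrightarrow> (\<Sum>K\<in>\<D>. norm (u (Sup K) - u (Inf K))) < \<epsilon>)"

definition test_function :: "real set \<Rightarrow> (real \<Rightarrow> real) \<Rightarrow> bool" where
  "test_function \<Omega> \<phi> \<longleftrightarrow>
     (\<forall>k x. (deriv ^^ k) \<phi> differentiable at x) \<and>
     compact (closure {x. \<phi> x \<noteq> 0}) \<and> closure {x. \<phi> x \<noteq> 0} \<subseteq> \<Omega>"

definition has_weak_derivative ::
    "real \<Rightarrow> real \<Rightarrow> (real \<Rightarrow> 'a::euclidean_space) \<Rightarrow> (real \<Rightarrow> 'a) \<Rightarrow> bool" where
  "has_weak_derivative a b u g \<longleftrightarrow>
     u absolutely_integrable_on {a<..<b} \<and> g absolutely_integrable_on {a<..<b} \<and>
     (\<forall>\<phi>. test_function {a<..<b} \<phi> \<longrightarrow>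
        (LINT t:{a<..<b}|lebesgue. deriv \<phi> t *\<^sub>R u t)
          = - (LINT t:{a<..<b}|lebesgue. \<phi> t *\<^sub>R g t))"

text \<open>
  Elements of the Sobolev space are represented by their absolutely continuous
  representatives on \<open>[a,b]\<close>; values outside \<open>[a,b]\<close> play no role.
\<close>

definition W11 :: "real \<Rightarrow> real \<Rightarrow> (real \<Rightarrow> 'a::euclidean_space) set" where
  "W11 a b = {u. abs_cont_on_interval a b u \<and> (\<exists>g. has_weak_derivative a b u g)}"

text \<open>A version of the weak derivative, which is unique up to null sets.\<close>

definition weak_derivative ::
    "real \<Rightarrow> real \<Rightarrow> (real \<Rightarrow> 'a::euclidean_space) \<Rightarrow> real \<Rightarrow> 'a" where
  "weak_derivative a b u = (SOME g. has_weak_derivative a b u g)"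

text \<open>
  The Lagrangian is only assumed real-valued, so the integral is formed in the extended
  reals as the integral of the positive part minus that of the negative part. If \<open>L\<close> is
  continuous and convex in its last argument and \<open>u\<close> lies in \<open>W11 a b\<close>, then
  \<open>L t (u t) p\<close> is bounded below by \<open>- C * (1 + norm p)\<close>, so the negative part has finite
  integral and no difference of infinities occurs.
\<close>

definition energy ::
    "real \<Rightarrow> real \<Rightarrow> (real \<Rightarrow> 'a \<Rightarrow> 'a \<Rightarrow> real) \<Rightarrow> (real \<Rightarrow> 'a::euclidean_space) \<Rightarrow> ereal" where
  "energy a b L u =
     enn2ereal (\<integral>\<^sup>+t\<in>{a<..<b}. ennreal (L t (u t) (weak_derivative a b u t)) \<partial>lebesgue)
     - enn2ereal (\<integral>\<^sup>+t\<in>{a<..<b}. ennreal (- L t (u t) (weak_derivative a b u t)) \<partial>lebesgue)"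

definition admissible ::
    "real \<Rightarrow> real \<Rightarrow> 'a \<Rightarrow> 'a \<Rightarrow> (real \<Rightarrow> 'a::euclidean_space) set" where
  "admissible a b A B = {u \<in> W11 a b. u a = A \<and> u b = B}"

definition is_minimizer ::
    "real \<Rightarrow> real \<Rightarrow> (real \<Rightarrow> 'a \<Rightarrow> 'a \<Rightarrow> real) \<Rightarrow> (real \<Rightarrow> 'a::euclidean_space) \<Rightarrow> bool" where
  "is_minimizer a b L v \<longleftrightarrow>
     v \<in> admissible a b (v a) (v b) \<and>
     (\<forall>u\<in>admissible a b (v a) (v b). energy a b L v \<le> energy a b L u)"

definition subgradient :: "('a::real_inner \<Rightarrow> real) \<Rightarrow> 'a \<Rightarrow> 'a \<Rightarrow> bool" where
  "subgradient f p \<xi> \<longleftrightarrow> (\<forall>q. f q \<ge> f p + \<xi> \<bullet> (q - p))"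

definition strict_convexity_SC ::
    "real \<Rightarrow> real \<Rightarrow> (real \<Rightarrow> 'a::real_inner \<Rightarrow> 'a \<Rightarrow> real) \<Rightarrow> bool" where
  "strict_convexity_SC a b L \<longleftrightarrow>
     (\<forall>R\<ge>1. \<exists>\<tau>>0. \<forall>t\<in>{a..b}. \<forall>y p. Max {\<bar>t\<bar>, norm y, norm p} \<le> R + 1 \<longrightarrow>
        (\<exists>\<xi>. subgradient (L t y) p \<xi> \<and>
             (\<forall>q. norm (q - p) \<ge> inverse R \<longrightarrow>
                L t y q \<ge> L t y p + \<xi> \<bullet> (q - p) + 2 * \<tau>)))"

definition has_left_derivative :: "(real \<Rightarrow> real ^ 'n) \<Rightarrow> real \<Rightarrow> ereal ^ 'n \<Rightarrow> bool" where
  "has_left_derivative v t d \<longleftrightarrow>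
     (\<forall>i. ((\<lambda>s. ereal ((v s $ i - v t $ i) / (s - t))) \<longlongrightarrow> d $ i) (at_left t))"

definition has_right_derivative :: "(real \<Rightarrow> real ^ 'n) \<Rightarrow> real \<Rightarrow> ereal ^ 'n \<Rightarrow> bool" where
  "has_right_derivative v t d \<longleftrightarrow>
     (\<forall>i. ((\<lambda>s. ereal ((v s $ i - v t $ i) / (s - t))) \<longlongrightarrow> d $ i) (at_right t))"

end

theory Submission
  imports Defs
begin

text \<open>
  A minimizer has no corners because cutting a corner pays off. Suppose that at \<open>t\<close> the left and right
  derivatives of \<open>v\<close> are \<open>pm \<noteq> pp\<close>, and replace \<open>v\<close> on \<open>{t-h..t+h}\<close> by its chord. The slope of the
  chord tends to the mean \<open>p = (pm + pp)/2\<close>, so by continuity of \<open>L\<close> the chord costs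
  \<open>2 * h * L t (v t) p\<close> up to a small multiple of \<open>h\<close>
  (\<open>minimizer_beats_chord\<close> says that \<open>v\<close> does not cost more). On the other hand let \<open>\<xi>\<close> be the
  subgradient of \<open>L t (v t)\<close> at \<open>p\<close> provided by strict convexity. For all \<open>(s, y)\<close> near \<open>(t, v t)\<close> and
  \<^emph>\<open>all\<close> slopes \<open>q\<close>, \<open>L s y q\<close> exceeds \<open>L t (v t) p + \<xi> \<bullet> (q - p)\<close> by about
  \<open>\<tau> * (norm (q - p) / r - 1)\<close> with \<open>r\<close> as small as desired. This
  is \<open>strict_convexity_SC_local_gap\<close>: by convexity the gap
  found on the compact sphere of radius \<open>r\<close> around \<open>p\<close> extends linearly to all larger \<open>q\<close>. The derivative
  of \<open>v\<close> has mean close to \<open>p\<close> on the whole interval but mean close to \<open>pm\<close> and \<open>pp\<close> on its two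
  halves, so its mean distance from \<open>p\<close> is at least about \<open>norm (pp - pm) / 2\<close>. Therefore \<open>v\<close>
  costs more than the chord by a positive multiple of \<open>h\<close>, which is absurd
  (\<open>minimizer_one_sided_derivatives_agree\<close>).

  Only mean values of the derivative of \<open>v\<close> enter, which are increments of \<open>v\<close> by the
  fundamental theorem of calculus. As derivatives are weak ones, defined by testing with smooth
  functions, the theorem needs a proof: \<open>weak_derivative_FTC\<close> tests
  with smooth approximations of indicator functions of intervals, built from \<open>exp (-1/x)\<close>.
  Conversely \<open>indefinite_integral_W11\<close> shows that indefinite integrals are Sobolev functions with the
  expected weak derivative. This makes the affine and the modified competitors admissible and, by the
  uniqueness of weak derivatives, allows their energies to be computed. The energies compared are finite:
  convexity bounds \<open>L\<close> from below by a linear function of the slope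
  (\<open>Lagrangian_linear_lower_bound\<close>), and the minimizer is not worse than an affine function.
\<close>

section \<open>Smooth test functions\<close>

text \<open>
  The functions \<open>P (1/x) * exp (-1/x)\<close> on \<open>x > 0\<close>, extended by \<open>0\<close>, where \<open>P\<close> is a
  polynomial: the derivatives of the standard flat function \<open>exp (-1/x)\<close> all have this shape, so
  allowing an arbitrary \<open>P\<close> makes the family closed under differentiation.
\<close>

definition exp_flat :: "real poly \<Rightarrow> real \<Rightarrow> real" where
  "exp_flat P x = (if x \<le> 0 then 0 else poly P (1 / x) * exp (- (1 / x)))"

text \<open>
  The only delicate point is \<open>x = 0\<close>: the difference quotient there is again a member of
  the family, and every member tends to \<open>0\<close> because \<open>exp\<close> beats every power.
\<close>

lemma exp_flat_deriv:
  "(exp_flat P has_real_derivative exp_flat (monom 1 2 * (P - pderiv P)) x) (at x)"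
proof -
  have lim: "((\<lambda>y. exp_flat Q y) \<longlongrightarrow> 0) (at_right 0)" for Q
  proof -
    have "((\<lambda>u. poly Q u * exp (- u)) \<longlongrightarrow> 0) at_top"
    proof -
      have "((\<lambda>u. \<Sum>i\<le>degree Q. coeff Q i * (u ^ i / exp u)) \<longlongrightarrow> (\<Sum>i\<le>degree Q. coeff Q i * 0)) at_top"
        by (intro tendsto_intros tendsto_power_div_exp_0)
      then show ?thesis
        by (simp add: poly_altdef sum_distrib_right exp_minus divide_inverse mult.assoc)
    qed
    then have "((\<lambda>y. poly Q (inverse y) * exp (- inverse y)) \<longlongrightarrow> 0) (at_right 0)"
      by (rule filterlim_compose[OF _ filterlim_inverse_at_top_right])
    then show ?thesis
      by (rule Lim_transform_eventually)
        (auto simp: eventually_at_filter exp_flat_def inverse_eq_divide)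
  qed
  consider "x < 0" | "x = 0" | "x > 0" by linarith
  then show ?thesis
  proof cases
    case 1
    have "((\<lambda>_. 0) has_real_derivative 0) (at x)" by simp
    then have "(exp_flat P has_real_derivative 0) (at x)"
      by (rule has_field_derivative_transform_within_open[of _ _ _ "{..<0}"])
        (use 1 in \<open>auto simp: exp_flat_def\<close>)
    then show ?thesis using 1 by (simp add: exp_flat_def)
  next
    case 2
    have "((\<lambda>y. exp_flat P y / y) \<longlongrightarrow> 0) (at_right 0)"
      by (rule Lim_transform_eventually[OF lim[of "monom 1 1 * P"]])
        (auto simp: eventually_at_filter exp_flat_def poly_monom divide_inverse)
    moreover have "((\<lambda>y. exp_flat P y / y) \<longlongrightarrow> 0) (at_left 0)"
      by (rule Lim_transform_eventually[OF tendsto_const])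
        (auto simp: eventually_at_filter exp_flat_def)
    ultimately have "((\<lambda>y. exp_flat P y / y) \<longlongrightarrow> 0) (at 0)"
      by (simp add: filterlim_split_at)
    then show ?thesis using 2 by (simp add: has_field_derivative_iff exp_flat_def)
  next
    case 3
    have "((\<lambda>x. poly P (1 / x) * exp (- (1 / x))) has_real_derivative
        exp_flat (monom 1 2 * (P - pderiv P)) x) (at x)"
      using 3 by (auto intro!: derivative_eq_intros simp: exp_flat_def poly_monom
        poly_DERIV power2_eq_square divide_inverse algebra_simps)
    then show ?thesis
      by (rule has_field_derivative_transform_within_open[of _ _ _ "{0<..}"])
        (use 3 in \<open>auto simp: exp_flat_def\<close>)
  qed
qed

text \<open>
  Smoothness is obtained by coinduction: a class of differentiable functions that contains the
  derivatives of its members consists of smooth functions. The class below is generated so as to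
  contain products of two flat functions, which are the bumps needed.
\<close>

inductive bump_algebra :: "(real \<Rightarrow> real) \<Rightarrow> bool" where
  const: "bump_algebra (\<lambda>x. c)"
| flat: "bump_algebra (\<lambda>x. exp_flat P (\<alpha> * x + \<beta>))"
| add: "bump_algebra f \<Longrightarrow> bump_algebra g \<Longrightarrow> bump_algebra (\<lambda>x. f x + g x)"
| mult: "bump_algebra f \<Longrightarrow> bump_algebra g \<Longrightarrow> bump_algebra (\<lambda>x. f x * g x)"

lemma bump_algebra_deriv:
  assumes "bump_algebra f"
  shows "\<exists>f'. bump_algebra f' \<and> (\<forall>x. (f has_real_derivative f' x) (at x))"
  using assms
proof induction
  case (const c)
  show ?case by (rule exI[of _ "\<lambda>x. 0"]) (auto intro: bump_algebra.const)
next
  case (flat P \<alpha> \<beta>)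
  let ?Q = "monom 1 2 * (P - pderiv P)"
  have "((\<lambda>x. exp_flat P (\<alpha> * x + \<beta>)) has_real_derivative exp_flat ?Q (\<alpha> * x + \<beta>) * \<alpha>) (at x)" for x
    by (rule DERIV_chain'[OF _ exp_flat_deriv]) (auto intro!: derivative_eq_intros)
  then show ?case
    by (intro exI[of _ "\<lambda>x. exp_flat ?Q (\<alpha> * x + \<beta>) * \<alpha>"])
      (auto intro: bump_algebra.intros)
next
  case (add f g)
  then obtain f' g' where *: "bump_algebra f'" "bump_algebra g'"
    "\<And>x. (f has_real_derivative f' x) (at x)" "\<And>x. (g has_real_derivative g' x) (at x)" by blast
  show ?case
    by (rule exI[of _ "\<lambda>x. f' x + g' x"]) (use * in \<open>auto intro!: bump_algebra.add DERIV_add\<close>)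
next
  case (mult f g)
  then obtain f' g' where *: "bump_algebra f'" "bump_algebra g'"
    "\<And>x. (f has_real_derivative f' x) (at x)" "\<And>x. (g has_real_derivative g' x) (at x)" by blast
  show ?case
    by (rule exI[of _ "\<lambda>x. f' x * g x + g' x * f x"])
      (use * mult.hyps in \<open>auto intro!: bump_algebra.mult bump_algebra.add DERIV_mult\<close>)
qed

lemma bump_algebra_continuous:
  assumes "bump_algebra f"
  shows "continuous_on S f"
  using bump_algebra_deriv[OF assms] DERIV_isCont continuous_at_imp_continuous_on by blast

lemma bump_algebra_smooth:
  assumes "bump_algebra f"
  shows "(deriv ^^ k) f differentiable at x"
proof -
  have "bump_algebra ((deriv ^^ k) f)"
  proof (induction k)
    case (Suc k)
    then obtain f' where "bump_algebra f'" "\<forall>x. ((deriv ^^ k) f has_real_derivative f' x) (at x)"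
      using bump_algebra_deriv by blast
    moreover from this have "(deriv ^^ Suc k) f = f'"
      by (auto intro: DERIV_imp_deriv)
    ultimately show ?case by simp
  qed (use assms in simp)
  then show ?thesis
    using bump_algebra_deriv by (meson real_differentiable_def)
qed

text \<open>
  Multiplying a flat function rising at \<open>c\<close> with a reflected one vanishing at \<open>d\<close> gives a bump,
  which is then normalised to have integral one.
\<close>

lemma smooth_bump_exists:
  fixes c d :: real
  assumes "c < d"
  obtains \<beta> where "bump_algebra \<beta>" "\<And>x. \<beta> x \<ge> 0" "\<And>x. x \<notin> {c..d} \<Longrightarrow> \<beta> x = 0"
    "(\<beta> has_integral 1) {c..d}"
proof -
  let ?f = "\<lambda>x. exp_flat 1 (1 * x + (- c)) * exp_flat 1 ((- 1) * x + d)"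
  have alg: "bump_algebra ?f" by (intro bump_algebra.intros)
  have nn: "?f x \<ge> 0" and z: "x \<notin> {c..d} \<Longrightarrow> ?f x = 0" for x by (auto simp: exp_flat_def)
  have cont: "continuous_on S ?f" for S
    using alg by (rule bump_algebra_continuous)
  define I where "I = integral {c..d} ?f"
  have hI: "(?f has_integral I) {c..d}"
    unfolding I_def by (intro integrable_integral integrable_continuous_real cont)
  have "I \<noteq> 0"
  proof
    assume "I = 0"
    then have "?f ((c + d) / 2) = 0"
      using assms cont[of "cbox c d"] nn hI
      by (intro has_integral_0_cbox_imp_0[of c d ?f]) auto
    moreover have "exp_flat 1 x > 0" if "x > 0" for x
      using that by (simp add: exp_flat_def)
    then have "exp_flat 1 (1 * ((c + d) / 2) + (- c)) > 0"
      "exp_flat 1 ((- 1) * ((c + d) / 2) + d) > 0"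
      using assms by (simp_all add: field_simps)
    ultimately show False by simp
  qed
  moreover have "I \<ge> 0" using hI nn by (rule has_integral_nonneg)
  ultimately have "I > 0" by simp
  show thesis
  proof (rule that[of "\<lambda>x. inverse I * ?f x"])
    show "bump_algebra (\<lambda>x. inverse I * ?f x)" by (intro bump_algebra.intros alg)
    show "((\<lambda>x. inverse I * ?f x) has_integral 1) {c..d}"
      using has_integral_mult_right[OF hI, of "inverse I"] \<open>I > 0\<close> by simp
  qed (use nn z \<open>I > 0\<close> in \<open>auto intro!: mult_nonneg_nonneg\<close>)
qed

section \<open>The fundamental theorem of calculus for weak derivatives\<close>

lemma continuous_scaleR_absolutely_integrable:
  fixes g :: "real \<Rightarrow> 'a::euclidean_space"
  assumes "continuous_on {a..b} \<phi>" "g absolutely_integrable_on {a..b}"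
  shows "(\<lambda>s. \<phi> s *\<^sub>R g s) absolutely_integrable_on {a..b}"
proof -
  obtain B where B: "\<And>s. s \<in> {a..b} \<Longrightarrow> \<bar>\<phi> s\<bar> \<le> B"
    using compact_imp_bounded[OF compact_continuous_image[OF assms(1) compact_Icc]]
    unfolding bounded_iff by (metis imageI real_norm_def)
  show ?thesis
  proof (rule measurable_bounded_by_integrable_imp_absolutely_integrable)
    show "(\<lambda>s. \<phi> s *\<^sub>R g s) \<in> borel_measurable (lebesgue_on {a..b})"
      using assms by (intro borel_measurable_scaleR continuous_imp_measurable_on_sets_lebesgue
        absolutely_integrable_imp_borel_measurable) auto
    show "(\<lambda>s. B * norm (g s)) integrable_on {a..b}"
      using assms(2) by (auto simp: absolutely_integrable_on_def intro: integrable_on_mult_right)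
    show "norm (\<phi> s *\<^sub>R g s) \<le> B * norm (g s)" if "s \<in> {a..b}" for s
      using B[OF that] by (simp add: mult_right_mono)
  qed auto
qed

text \<open>
  A smooth approximation \<open>\<phi>\<close> of the indicator function of an interval: \<open>\<phi>\<close> is the primitive of a bump
  \<open>\<beta>\<close> minus a bump \<open>\<gamma>\<close>, so that \<open>\<phi>\<close> climbs to one at the left end and falls back to zero at the
  right end. Used in the definition of the weak derivative, its derivative evaluates a function
  near both ends of the interval, while \<open>\<phi>\<close> itself integrates the weak derivative in between.
\<close>

lemma smooth_plateau_exists:
  fixes c d c' d' :: real
  assumes "a < c" "c < d" "d \<le> c'" "c' < d'" "d' < b"
  obtains \<phi> \<beta> \<gamma> where
    "test_function {a<..<b} \<phi>" "deriv \<phi> = (\<lambda>s. \<beta> s - \<gamma> s)"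
    "\<And>s. 0 \<le> \<phi> s \<and> \<phi> s \<le> 1" "\<And>s. s \<in> {d..c'} \<Longrightarrow> \<phi> s = 1" "\<And>s. s \<notin> {c..d'} \<Longrightarrow> \<phi> s = 0"
    "continuous_on UNIV \<phi>"
    "continuous_on UNIV \<beta>" "\<And>s. \<beta> s \<ge> 0" "\<And>s. s \<notin> {c..d} \<Longrightarrow> \<beta> s = 0" "(\<beta> has_integral 1) {c..d}"
    "continuous_on UNIV \<gamma>" "\<And>s. \<gamma> s \<ge> 0" "\<And>s. s \<notin> {c'..d'} \<Longrightarrow> \<gamma> s = 0" "(\<gamma> has_integral 1) {c'..d'}"
proof -
  obtain \<beta> where \<beta>: "bump_algebra \<beta>" "\<And>s. \<beta> s \<ge> 0" "\<And>s. s \<notin> {c..d} \<Longrightarrow> \<beta> s = 0"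
    "(\<beta> has_integral 1) {c..d}" using smooth_bump_exists[OF assms(2)] by blast
  obtain \<gamma> where \<gamma>: "bump_algebra \<gamma>" "\<And>s. \<gamma> s \<ge> 0" "\<And>s. s \<notin> {c'..d'} \<Longrightarrow> \<gamma> s = 0"
    "(\<gamma> has_integral 1) {c'..d'}" using smooth_bump_exists[OF assms(4)] by blast
  have cont: "continuous_on S \<beta>" "continuous_on S \<gamma>" for S
    using \<beta>(1) \<gamma>(1) by (auto intro: bump_algebra_continuous)
  define I where "I \<delta> s = integral {a..s} \<delta>" for \<delta> :: "real \<Rightarrow> real" and s
  define \<phi> where "\<phi> s = I \<beta> s - I \<gamma> s" for s
  have I0: "I \<delta> s = 0" if "\<And>s. s \<notin> {e..f} \<Longrightarrow> \<delta> s = 0" "s < e" for \<delta> s e f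
  proof -
    have "I \<delta> s = integral {a..s} (\<lambda>_. 0)"
      unfolding I_def by (rule integral_cong) (use that in auto)
    then show ?thesis by simp
  qed
  have I1: "I \<delta> s = 1" if "\<And>s. s \<notin> {e..f} \<Longrightarrow> \<delta> s = 0" "(\<delta> has_integral 1) {e..f}" "a < e" "f \<le> s" for \<delta> s e f
    unfolding I_def using that by (intro integral_unique has_integral_on_superset[OF that(2)]) auto
  have I01: "0 \<le> I \<delta> s \<and> I \<delta> s \<le> 1" if "bump_algebra \<delta>" "\<And>s. \<delta> s \<ge> 0" "\<And>s. s \<notin> {e..f} \<Longrightarrow> \<delta> s = 0" "(\<delta> has_integral 1) {e..f}" "a < e" for \<delta> s e f
  proof
    have int: "\<delta> integrable_on {x..y}" for x y
      using that(1) by (intro integrable_continuous_real bump_algebra_continuous)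
    show "0 \<le> I \<delta> s" unfolding I_def using that(2) by (intro integral_nonneg int) auto
    show "I \<delta> s \<le> 1"
    proof (cases "s \<le> f")
      case True
      have "I \<delta> s \<le> I \<delta> f" unfolding I_def
        by (rule integral_subset_le) (use True that(2) int in auto)
      then show ?thesis using I1[of e f \<delta> f, OF that(3,4,5)] by simp
    next
      case False
      then show ?thesis using I1[of e f \<delta> s, OF that(3,4,5)] by simp
    qed
  qed
  have deriv: "(\<phi> has_real_derivative \<beta> s - \<gamma> s) (at s)" for s
  proof (cases "s < c")
    case True
    have "((\<lambda>_. 0) has_real_derivative 0) (at s)" by simp
    then have "(\<phi> has_real_derivative 0) (at s)"
      by (rule has_field_derivative_transform_within_open[of _ _ _ "{..<c}"])
        (use True assms I0[of c d \<beta>] I0[of c' d' \<gamma>] \<beta> \<gamma> in \<open>auto simp: \<phi>_def\<close>)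
    then show ?thesis using True assms \<beta>(3) \<gamma>(3) by simp
  next
    case False
    have "(I \<delta> has_real_derivative \<delta> s) (at s)" if "continuous_on {a..s+1} \<delta>" for \<delta>
    proof -
      have "((\<lambda>s. integral {a..s} \<delta>) has_real_derivative \<delta> s) (at s within {a..s+1})"
        using that by (rule integral_has_real_derivative) (use False assms in auto)
      moreover have "at s within {a..s+1} = at s"
        by (rule at_within_interior) (use False assms in auto)
      ultimately show ?thesis unfolding I_def[abs_def] by simp
    qed
    then show ?thesis
      unfolding \<phi>_def[abs_def] by (auto intro!: DERIV_diff cont)
  qed
  then have deriv_eq: "deriv \<phi> = (\<lambda>s. \<beta> s - \<gamma> s)" by (auto intro: DERIV_imp_deriv)
  have zero: "\<phi> s = 0" if "s \<notin> {c..d'}" for s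
    using that assms I0[of c d \<beta> s] I0[of c' d' \<gamma> s] I1[of c d \<beta> s] I1[of c' d' \<gamma> s] \<beta>(3,4) \<gamma>(3,4)
    by (cases "s < c") (auto simp: \<phi>_def)
  have one: "\<phi> s = 1" if "s \<in> {d..c'}" for s
  proof -
    have "(\<gamma> has_integral 0) {a..s}"
      by (rule has_integral_spike_finite[of "{c'}" _ _ "\<lambda>_. 0"]) (use that \<gamma>(3) in auto)
    then have "I \<gamma> s = 0" unfolding I_def by (rule integral_unique)
    then show ?thesis using that assms I1[of c d \<beta> s] \<beta>(3,4) by (auto simp: \<phi>_def)
  qed
  have bd: "0 \<le> \<phi> s \<and> \<phi> s \<le> 1" for s
  proof (cases "s < c'")
    case True
    then show ?thesis
      using I0[of c' d' \<gamma> s] I01[of \<beta> c d s] \<beta> \<gamma>(3) assms by (auto simp: \<phi>_def)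
  next
    case False
    then show ?thesis
      using I1[of c d \<beta> s] I01[of \<gamma> c' d' s] \<beta>(3,4) \<gamma> assms by (auto simp: \<phi>_def)
  qed
  have alg: "bump_algebra (\<lambda>s. \<beta> s - \<gamma> s)"
    using bump_algebra.add[OF \<beta>(1) bump_algebra.mult[OF bump_algebra.const[of "-1"] \<gamma>(1)]] by simp
  have "(deriv ^^ k) \<phi> differentiable at s" for k s
  proof (cases k)
    case 0
    then show ?thesis using deriv real_differentiable_def by auto
  next
    case (Suc m)
    then have "(deriv ^^ k) \<phi> = (deriv ^^ m) (\<lambda>s. \<beta> s - \<gamma> s)"
      by (simp add: funpow_Suc_right deriv_eq del: funpow.simps)
    then show ?thesis using bump_algebra_smooth[OF alg] by simp
  qed
  moreover have supp: "closure {s. \<phi> s \<noteq> 0} \<subseteq> {c..d'}"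
    by (rule closure_minimal) (use zero in blast, simp)
  moreover have "compact (closure {s. \<phi> s \<noteq> 0})"
    using bounded_subset[OF bounded_closed_interval supp] by (simp add: compact_eq_bounded_closed)
  ultimately have "test_function {a<..<b} \<phi>"
    using assms by (auto simp: test_function_def)
  moreover have "continuous_on UNIV \<phi>"
    using deriv DERIV_isCont continuous_at_imp_continuous_on by blast
  ultimately show thesis
    using that deriv_eq bd one zero cont \<beta>(2-4) \<gamma>(2-4) by blast
qed

lemma has_integral_norm_le:
  fixes f :: "'a::euclidean_space \<Rightarrow> 'b::banach"
  assumes "(f has_integral i) S" "(h has_integral j) S" "\<And>x. x \<in> S \<Longrightarrow> norm (f x) \<le> h x"
  shows "norm i \<le> j"
  using has_integral_norm_bound_integral_component[of f i S h j 1] assms by simp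

text \<open>
  Integration against a bump of mass one averages the function, so it moves the value by at most
  the oscillation on the support of the bump.
\<close>

lemma approximate_point_evaluation:
  fixes u :: "real \<Rightarrow> 'a::euclidean_space"
  assumes "continuous_on {c..d} u" "continuous_on UNIV \<beta>" "\<And>s. \<beta> s \<ge> 0" "(\<beta> has_integral 1) {c..d}"
    "\<And>s. s \<in> {c..d} \<Longrightarrow> norm (u s - z) \<le> e"
  shows "norm (integral {c..d} (\<lambda>s. \<beta> s *\<^sub>R u s) - z) \<le> e"
proof -
  have c: "continuous_on {c..d} \<beta>" using assms(2) by (rule continuous_on_subset) auto
  have "((\<lambda>s. \<beta> s *\<^sub>R z) has_integral 1 *\<^sub>R z) {c..d}"
    using assms(4) by (rule has_integral_scaleR_left)
  moreover have "((\<lambda>s. \<beta> s *\<^sub>R u s) has_integral integral {c..d} (\<lambda>s. \<beta> s *\<^sub>R u s)) {c..d}"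
    by (intro integrable_integral integrable_continuous_real continuous_intros c assms(1))
  ultimately have *: "((\<lambda>s. \<beta> s *\<^sub>R u s - \<beta> s *\<^sub>R z) has_integral integral {c..d} (\<lambda>s. \<beta> s *\<^sub>R u s) - 1 *\<^sub>R z) {c..d}"
    by (rule has_integral_diff[rotated])
  have "((\<lambda>s. \<beta> s * e) has_integral 1 * e) {c..d}"
    using assms(4) by (rule has_integral_mult_left)
  from has_integral_norm_le[OF * this]
  show ?thesis using assms(3,5)
    by (simp add: mult_left_mono flip: scaleR_diff_right)
qed

text \<open>
  Testing the weak derivative with plateau functions whose flanks \<open>{x..x+\<delta>}\<close> and \<open>{y-\<delta>..y}\<close> shrink:
  the left side tends to \<open>u x - u y\<close> by continuity of \<open>u\<close>, and the right side tends to
  the integral of \<open>g\<close> over \<open>{x..y}\<close>, since the flanks contribute little to the integral of \<open>norm g\<close>.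
\<close>

lemma weak_derivative_FTC_interior:
  fixes u g :: "real \<Rightarrow> 'a::euclidean_space"
  assumes wd: "has_weak_derivative a b u g" and cu: "continuous_on {a..b} u" and xy: "a < x" "x < y" "y < b"
  shows "u y - u x = integral {x..y} g"
proof -
  have ig: "g absolutely_integrable_on {a..b}"
    using wd by (simp add: has_weak_derivative_def absolutely_integrable_on_Icc_iff_Ioo)
  then have igxy: "g absolutely_integrable_on {x..y}"
    by (rule absolutely_integrable_on_subinterval) (use xy in auto)
  then have ng: "(\<lambda>s. norm (g s)) integrable_on {x..y}" by (simp add: absolutely_integrable_on_def)
  have est: "norm (u y - u x - integral {x..y} g) \<le> 4 * e" if "e > 0" for e
  proof -
    have "isCont u x" "isCont u y"
      using continuous_on_interior[OF cu] xy by auto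
    then obtain d1 d2 where d1: "d1 > 0" "\<And>s. dist s x < d1 \<Longrightarrow> dist (u s) (u x) < e"
      and d2: "d2 > 0" "\<And>s. dist s y < d2 \<Longrightarrow> dist (u s) (u y) < e"
      using \<open>e > 0\<close> unfolding continuous_at_eps_delta by metis
    define N where "N p q = integral {p..q} (\<lambda>s. norm (g s))" for p q
    have cN: "continuous_on {x..y} (\<lambda>t. N x t)"
      unfolding N_def using ng by (rule indefinite_integral_continuous_1)
    obtain d3 where d3: "d3 > 0" "\<And>t. t \<in> {x..y} \<Longrightarrow> dist t x < d3 \<Longrightarrow> dist (N x t) (N x x) < e"
      using cN[unfolded continuous_on_iff, rule_format, of x e] xy \<open>e > 0\<close> by auto
    obtain d4 where d4: "d4 > 0" "\<And>t. t \<in> {x..y} \<Longrightarrow> dist t y < d4 \<Longrightarrow> dist (N x t) (N x y) < e"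
      using cN[unfolded continuous_on_iff, rule_format, of y e] xy \<open>e > 0\<close> by auto
    have "\<exists>\<delta>>0. \<delta> < d1 \<and> \<delta> < d2 \<and> \<delta> < d3 \<and> \<delta> < d4 \<and> \<delta> < (y - x) / 2"
      using field_lbound_gt_zero[of "min d1 d2" "min d3 (min d4 ((y - x) / 2))"] d1 d2 d3 d4 xy by auto
    then obtain \<delta> where \<delta>: "\<delta> > 0" "\<delta> < d1" "\<delta> < d2" "\<delta> < d3" "\<delta> < d4" "\<delta> < (y - x) / 2"
      by blast
    obtain \<phi> \<beta> \<gamma> where
      \<phi>: "test_function {a<..<b} \<phi>" "deriv \<phi> = (\<lambda>s. \<beta> s - \<gamma> s)"
        "\<And>s. 0 \<le> \<phi> s \<and> \<phi> s \<le> 1" "\<And>s. s \<in> {x+\<delta>..y-\<delta>} \<Longrightarrow> \<phi> s = 1" "\<And>s. s \<notin> {x..y} \<Longrightarrow> \<phi> s = 0"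
        "continuous_on UNIV \<phi>" and
      \<beta>: "continuous_on UNIV \<beta>" "\<And>s. \<beta> s \<ge> 0" "\<And>s. s \<notin> {x..x+\<delta>} \<Longrightarrow> \<beta> s = 0" "(\<beta> has_integral 1) {x..x+\<delta>}" and
      \<gamma>: "continuous_on UNIV \<gamma>" "\<And>s. \<gamma> s \<ge> 0" "\<And>s. s \<notin> {y-\<delta>..y} \<Longrightarrow> \<gamma> s = 0" "(\<gamma> has_integral 1) {y-\<delta>..y}"
    proof (rule smooth_plateau_exists[of a x "x + \<delta>" "y - \<delta>" y b])
    qed (use xy \<delta> in auto)
    have c: "continuous_on S \<phi>" "continuous_on S \<beta>" "continuous_on S \<gamma>" for S
      using \<phi>(6) \<beta>(1) \<gamma>(1) continuous_on_subset by blast+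
    have cu': "continuous_on {p..q} u" if "a \<le> p" "q \<le> b" for p q
      using cu by (rule continuous_on_subset) (use that in auto)
    have LHS: "(LINT s:{a<..<b}|lebesgue. deriv \<phi> s *\<^sub>R u s)
      = integral {x..x+\<delta>} (\<lambda>s. \<beta> s *\<^sub>R u s) - integral {y-\<delta>..y} (\<lambda>s. \<gamma> s *\<^sub>R u s)"
    proof -
      have ab: "(\<lambda>s. deriv \<phi> s *\<^sub>R u s) absolutely_integrable_on {a<..<b}"
        unfolding \<phi>(2) absolutely_integrable_on_Icc_iff_Ioo[symmetric]
        by (intro absolutely_integrable_continuous_real continuous_intros c cu)
      have "(\<lambda>s. \<beta> s *\<^sub>R u s) integrable_on {x..x+\<delta>}" "(\<lambda>s. \<gamma> s *\<^sub>R u s) integrable_on {y-\<delta>..y}"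
        using xy \<delta> by (auto intro!: integrable_continuous_real continuous_intros c cu')
      from this[THEN integrable_integral]
      have "((\<lambda>s. \<beta> s *\<^sub>R u s) has_integral integral {x..x+\<delta>} (\<lambda>s. \<beta> s *\<^sub>R u s)) {a<..<b}"
        "((\<lambda>s. \<gamma> s *\<^sub>R u s) has_integral integral {y-\<delta>..y} (\<lambda>s. \<gamma> s *\<^sub>R u s)) {a<..<b}"
        using xy \<delta> \<beta>(3) \<gamma>(3) by (auto elim!: has_integral_on_superset)
      from has_integral_diff[OF this] show ?thesis
        by (subst set_lebesgue_integral_eq_integral(2)[OF ab])
          (simp add: \<phi>(2) scaleR_diff_left integral_unique)
    qed
    have RHS: "(LINT s:{a<..<b}|lebesgue. \<phi> s *\<^sub>R g s) = integral {x..y} (\<lambda>s. \<phi> s *\<^sub>R g s)"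
    proof -
      have ab: "(\<lambda>s. \<phi> s *\<^sub>R g s) absolutely_integrable_on {a<..<b}"
        unfolding absolutely_integrable_on_Icc_iff_Ioo[symmetric]
        by (intro continuous_scaleR_absolutely_integrable c ig)
      have "(\<lambda>s. \<phi> s *\<^sub>R g s) integrable_on {x..y}"
        by (intro set_lebesgue_integral_eq_integral(1) continuous_scaleR_absolutely_integrable c igxy)
      then have "((\<lambda>s. \<phi> s *\<^sub>R g s) has_integral integral {x..y} (\<lambda>s. \<phi> s *\<^sub>R g s)) {a<..<b}"
        by (rule has_integral_on_superset[OF integrable_integral]) (use \<phi>(5) xy in auto)
      then show ?thesis
        unfolding set_lebesgue_integral_eq_integral(2)[OF ab] by (rule integral_unique)
    qed
    have bx: "norm (integral {x..x+\<delta>} (\<lambda>s. \<beta> s *\<^sub>R u s) - u x) \<le> e"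
      using xy \<delta> d1 by (intro approximate_point_evaluation \<beta> cu') (auto simp: dist_norm less_imp_le)
    have by_est: "norm (integral {y-\<delta>..y} (\<lambda>s. \<gamma> s *\<^sub>R u s) - u y) \<le> e"
      using xy \<delta> d2 by (intro approximate_point_evaluation \<gamma> cu') (auto simp: dist_norm less_imp_le)
    have bg: "norm (integral {x..y} (\<lambda>s. \<phi> s *\<^sub>R g s) - integral {x..y} g) \<le> 2 * e"
    proof -
      have "((\<lambda>s. \<phi> s *\<^sub>R g s) has_integral integral {x..y} (\<lambda>s. \<phi> s *\<^sub>R g s)) {x..y}"
        by (intro integrable_integral set_lebesgue_integral_eq_integral(1)
          continuous_scaleR_absolutely_integrable c igxy)
      moreover have "(g has_integral integral {x..y} g) {x..y}"
        using igxy by (auto simp: absolutely_integrable_on_def)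
      ultimately have *: "((\<lambda>s. \<phi> s *\<^sub>R g s - g s) has_integral
          integral {x..y} (\<lambda>s. \<phi> s *\<^sub>R g s) - integral {x..y} g) {x..y}"
        by (rule has_integral_diff)
      let ?n = "\<lambda>s. norm (g s)"
      have ngs: "?n integrable_on {p..q}" if "x \<le> p" "q \<le> y" for p q
        using ng by (rule integrable_on_subinterval) (use that in auto)
      have "((\<lambda>s. if s \<in> {x..x+\<delta>} then ?n s else 0) has_integral N x (x+\<delta>)) {x..y}"
        "((\<lambda>s. if s \<in> {y-\<delta>..y} then ?n s else 0) has_integral N (y-\<delta>) y) {x..y}"
        unfolding N_def by (subst has_integral_restrict; use \<delta> in \<open>auto intro!: integrable_integral ngs\<close>)+
      from has_integral_add[OF this]
      have "norm (integral {x..y} (\<lambda>s. \<phi> s *\<^sub>R g s) - integral {x..y} g) \<le> N x (x+\<delta>) + N (y-\<delta>) y"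
      proof (rule has_integral_norm_le[OF *])
        fix s assume "s \<in> {x..y}"
        have "norm (\<phi> s *\<^sub>R g s - g s) = \<bar>\<phi> s - 1\<bar> * ?n s"
          by (metis norm_scaleR scaleR_diff_left scaleR_one)
        also have "\<dots> \<le> (if s \<in> {x+\<delta>..y-\<delta>} then 0 else 1) * ?n s"
          using \<phi>(3)[of s] \<phi>(4)[of s] by (intro mult_right_mono) auto
        also have "\<dots> \<le> (if s \<in> {x..x+\<delta>} then ?n s else 0) + (if s \<in> {y-\<delta>..y} then ?n s else 0)"
          using \<open>s \<in> {x..y}\<close> by auto
        finally show "norm (\<phi> s *\<^sub>R g s - g s)
          \<le> (if s \<in> {x..x+\<delta>} then ?n s else 0) + (if s \<in> {y-\<delta>..y} then ?n s else 0)" .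
      qed
      moreover have "N x (x+\<delta>) \<le> e"
        using d3(2)[of "x+\<delta>"] \<delta> by (simp add: N_def dist_norm)
      moreover have "N x (y-\<delta>) + N (y-\<delta>) y = N x y"
        unfolding N_def by (rule Henstock_Kurzweil_Integration.integral_combine) (use \<delta> ng in auto)
      then have "N (y-\<delta>) y \<le> e"
        using d4(2)[of "y-\<delta>"] \<delta> by (simp add: dist_norm)
      ultimately show ?thesis by linarith
    qed
    have "integral {x..x+\<delta>} (\<lambda>s. \<beta> s *\<^sub>R u s) - integral {y-\<delta>..y} (\<lambda>s. \<gamma> s *\<^sub>R u s)
      = - integral {x..y} (\<lambda>s. \<phi> s *\<^sub>R g s)"
      using wd \<phi>(1) LHS RHS unfolding has_weak_derivative_def by metis
    then have "u y - u x - integral {x..y} g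
      = (integral {x..x+\<delta>} (\<lambda>s. \<beta> s *\<^sub>R u s) - u x) - (integral {y-\<delta>..y} (\<lambda>s. \<gamma> s *\<^sub>R u s) - u y)
        + (integral {x..y} (\<lambda>s. \<phi> s *\<^sub>R g s) - integral {x..y} g)"
      by (simp add: algebra_simps)
    also have "norm \<dots> \<le> e + e + 2 * e"
      using bx by_est bg norm_triangle_ineq4 norm_triangle_ineq by (smt (verit, best))
    finally show ?thesis by simp
  qed
  have "norm (u y - u x - integral {x..y} g) = 0"
    using est[of "norm (u y - u x - integral {x..y} g) / 8"] by fastforce
  then show ?thesis by simp
qed

text \<open>
  A division consisting of a single interval already gives uniform continuity.
\<close>

lemma abs_cont_on_interval_continuous:
  fixes u :: "real \<Rightarrow> 'a::real_normed_vector"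
  assumes "abs_cont_on_interval a b u"
  shows "continuous_on {a..b} u"
proof (rule continuous_onI)
  fix x e assume x: "x \<in> {a..b}" and e: "(e::real) > 0"
  from assms e obtain d where d: "d > 0" "\<And>\<D> S. \<D> division_of S \<Longrightarrow> S \<subseteq> {a..b} \<Longrightarrow>
      (\<Sum>K\<in>\<D>. Sup K - Inf K) < d \<Longrightarrow> (\<Sum>K\<in>\<D>. norm (u (Sup K) - u (Inf K))) < e"
    unfolding abs_cont_on_interval_def by metis
  have *: "norm (u q - u p) < e" if "p \<le> q" "p \<in> {a..b}" "q \<in> {a..b}" "q - p < d" for p q
    using d(2)[of "{{p..q}}" "{p..q}"] that division_of_self[of p q] by auto
  have "dist (u y) (u x) \<le> e" if "y \<in> {a..b}" "dist y x < d" for y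
    using *[of x y] *[of y x] that x
    by (cases "x \<le> y") (auto simp: dist_norm norm_minus_commute less_imp_le)
  then show "\<exists>d>0. \<forall>x'\<in>{a..b}. dist x' x < d \<longrightarrow> dist (u x') (u x) \<le> e"
    using d(1) by blast
qed

text \<open>
  Test functions vanish near the ends of the interval; the end points are reached by continuity of
  both sides.
\<close>

lemma weak_derivative_FTC:
  fixes u g :: "real \<Rightarrow> 'a::euclidean_space"
  assumes wd: "has_weak_derivative a b u g" and ac: "abs_cont_on_interval a b u"
    and xy: "a \<le> x" "x \<le> y" "y \<le> b"
  shows "u y - u x = integral {x..y} g"
proof (cases "a < b")
  case True
  have cu: "continuous_on {a..b} u" using ac by (rule abs_cont_on_interval_continuous)
  have ig: "g integrable_on {a..b}"
    using wd by (auto simp: has_weak_derivative_def absolutely_integrable_on_def integrable_on_Icc_iff_Ioo)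
  let ?G = "\<lambda>s. u s - integral {a..s} g"
  obtain m where m: "a < m" "m < b" using dense[OF True] by blast
  have comb: "integral {a..p} g + integral {p..q} g = integral {a..q} g" if "a \<le> p" "p \<le> q" "q \<le> b" for p q
    by (rule Henstock_Kurzweil_Integration.integral_combine) (use that integrable_on_subinterval[OF ig] in auto)
  have "?G s = ?G m" if "s \<in> {a<..<b}" for s
  proof -
    consider "s < m" | "s = m" | "m < s" by linarith
    then show ?thesis
      by cases (use weak_derivative_FTC_interior[OF wd cu, of s m] weak_derivative_FTC_interior[OF wd cu, of m s]
        comb[of s m] comb[of m s] that m in \<open>auto simp: algebra_simps\<close>)
  qed
  moreover have "continuous_on (closure {a<..<b}) ?G"
    using True by (auto intro!: continuous_intros cu indefinite_integral_continuous_1 ig)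
  ultimately have "?G s = ?G m" if "s \<in> {a..b}" for s
    using continuous_constant_on_closure[of "{a<..<b}" ?G "?G m" s] that True by auto
  then have "?G x = ?G y" using xy by auto
  then show ?thesis
    unfolding comb[of x y, OF xy, symmetric] by (simp add: algebra_simps)
next
  case False
  then have "x = y" using xy by simp
  then show ?thesis by simp
qed

section \<open>Uniqueness of weak derivatives\<close>

text \<open>
  This makes Fubini's theorem available for the completed measure; it is needed below because weak
  derivatives are merely Lebesgue measurable.
\<close>

lemma sigma_finite_lebesgue: "sigma_finite_measure (lebesgue :: 'a::euclidean_space measure)"
proof
  let ?A = "range (\<lambda>n::nat. box (- real n *\<^sub>R One) (real n *\<^sub>R One)) :: 'a set set"
  have "\<Union>?A = UNIV" using UN_box_eq_UNIV by simp
  show "\<exists>A. countable A \<and> A \<subseteq> sets lebesgue \<and> \<Union>A = space lebesgue \<and> (\<forall>a\<in>A. emeasure (lebesgue::'a measure) a \<noteq> \<infinity>)"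
    by (rule exI[of _ ?A]) (use \<open>\<Union>?A = UNIV\<close> in \<open>auto simp: emeasure_lborel_box_eq\<close>)
qed

text \<open>
  If all interval integrals vanish, then the positive and the negative part of \<open>g\<close> are the densities
  of two measures that agree on all half-lines, hence are equal; uniqueness of densities finishes the
  argument. It is carried out for a Borel version \<open>f\<close> of \<open>g\<close>.
\<close>

lemma AE_zero_of_subinterval_integrals_real:
  fixes g :: "real \<Rightarrow> real"
  assumes ig: "g absolutely_integrable_on {a..b}"
    and z: "\<And>x y. a \<le> x \<Longrightarrow> x \<le> y \<Longrightarrow> y \<le> b \<Longrightarrow> integral {x..y} g = 0"
  shows "AE s in lebesgue. s \<in> {a..b} \<longrightarrow> g s = 0"
proof -
  let ?G = "\<lambda>s. indicator {a..b} s *\<^sub>R g s"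
  have iG: "integrable lebesgue ?G" using ig by (simp add: set_integrable_def)
  obtain f where f[measurable]: "f \<in> borel_measurable lborel" and fG: "AE s in lborel. ?G s = f s"
    using completion_ex_borel_measurable_real[OF borel_measurable_integrable[OF iG]] by blast
  have fG': "AE s in lebesgue. ?G s = f s" using fG by (rule AE_completion)
  have "integrable lebesgue f"
    by (rule integrable_cong_AE_imp[OF iG]) (use fG' in \<open>auto simp: measurable_completion\<close>)
  then have f_int: "integrable lborel f" by (simp add: integrable_completion)
  have f0: "(LINT s:{x<..}|lborel. f s) = 0" for x
  proof -
    let ?m = "max x a"
    have "(LINT s:{x<..}|lborel. f s) = (LINT s:{x<..}|lebesgue. f s)"
      unfolding set_lebesgue_integral_def by (rule integral_completion[symmetric]) simp
    also have "\<dots> = (\<integral>s. indicator {x<..} s *\<^sub>R ?G s \<partial>lebesgue)"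
      unfolding set_lebesgue_integral_def
    proof (rule integral_cong_AE)
      show "(\<lambda>s. indicator {x<..} s *\<^sub>R ?G s) \<in> borel_measurable lebesgue"
        by (rule borel_measurable_scaleR[OF borel_measurable_indicator borel_measurable_integrable[OF iG]]) simp
    qed (use fG' in \<open>auto simp: measurable_completion elim!: eventually_mono\<close>)
    also have "\<dots> = (LINT s:{x<..} \<inter> {a..b}|lebesgue. g s)"
      unfolding set_lebesgue_integral_def by (intro Bochner_Integration.integral_cong) (auto simp: indicator_def)
    also have "\<dots> = integral ({x<..} \<inter> {a..b}) g"
      by (rule set_lebesgue_integral_eq_integral) (rule set_integrable_subset[OF ig], auto)
    also have "\<dots> = integral {?m..b} g"
    proof (rule integral_subset_negligible)
      have "{?m..b} - {x<..} \<inter> {a..b} \<subseteq> {x}" by auto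
      then show "negligible ({?m..b} - {x<..} \<inter> {a..b})" by (rule negligible_subset[rotated]) simp
    qed auto
    also have "\<dots> = 0"
    proof (cases "?m \<le> b")
      case False
      then have "{?m..b} = {}" by auto
      then show ?thesis by simp
    qed (rule z, auto)
    finally show ?thesis .
  qed
  have eq: "(\<integral>\<^sup>+s\<in>{x<..}. ennreal (f s) \<partial>lborel) = (\<integral>\<^sup>+s\<in>{x<..}. ennreal (- f s) \<partial>lborel)"
    and fin: "(\<integral>\<^sup>+s\<in>{x<..}. ennreal (f s) \<partial>lborel) < \<infinity>" for x
  proof -
    let ?i = "indicator {x<..} :: real \<Rightarrow> real"
    have int: "integrable lborel (\<lambda>s. ?i s * max (f s) 0)" "integrable lborel (\<lambda>s. ?i s * max (- f s) 0)"
      by (rule Bochner_Integration.integrable_bound[OF f_int]; auto simp: indicator_def)+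
    have A: "(\<integral>\<^sup>+s\<in>{x<..}. ennreal (f s) \<partial>lborel) = ennreal (\<integral>s. ?i s * max (f s) 0 \<partial>lborel)"
      by (subst nn_integral_eq_integral[OF int(1), symmetric])
        (auto simp: indicator_def max_def ennreal_neg intro!: nn_integral_cong)
    have B: "(\<integral>\<^sup>+s\<in>{x<..}. ennreal (- f s) \<partial>lborel) = ennreal (\<integral>s. ?i s * max (- f s) 0 \<partial>lborel)"
      by (subst nn_integral_eq_integral[OF int(2), symmetric])
        (auto simp: indicator_def max_def ennreal_neg intro!: nn_integral_cong)
    have "(\<integral>s. ?i s * max (f s) 0 \<partial>lborel) - (\<integral>s. ?i s * max (- f s) 0 \<partial>lborel) = (LINT s:{x<..}|lborel. f s)"
      unfolding Bochner_Integration.integral_diff[OF int, symmetric] set_lebesgue_integral_def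
      by (intro Bochner_Integration.integral_cong) (auto simp: max_def indicator_def)
    then show "(\<integral>\<^sup>+s\<in>{x<..}. ennreal (f s) \<partial>lborel) = (\<integral>\<^sup>+s\<in>{x<..}. ennreal (- f s) \<partial>lborel)"
      "(\<integral>\<^sup>+s\<in>{x<..}. ennreal (f s) \<partial>lborel) < \<infinity>" using A B f0[of x] by auto
  qed
  have "density lborel (\<lambda>s. ennreal (f s)) = density lborel (\<lambda>s. ennreal (- f s))"
    by (rule measure_eqI_lessThan) (use eq fin in \<open>auto simp: emeasure_density\<close>)
  then have "AE s in lborel. ennreal (f s) = ennreal (- f s)"
    by (subst (asm) sigma_finite_measure.density_unique_iff[OF sigma_finite_lborel]) auto
  then have "AE s in lborel. f s = 0"
  proof (rule eventually_mono)
    fix s assume "ennreal (f s) = ennreal (- f s)"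
    then show "f s = 0"
      by (cases "f s \<ge> 0") (auto simp: ennreal_neg)
  qed
  then have "AE s in lborel. s \<in> {a..b} \<longrightarrow> g s = 0"
    using fG by eventually_elim (auto simp: indicator_def)
  then show ?thesis by (rule AE_completion)
qed

lemma AE_zero_of_subinterval_integrals:
  fixes g :: "real \<Rightarrow> 'a::euclidean_space"
  assumes ig: "g absolutely_integrable_on {a..b}"
    and z: "\<And>x y. a \<le> x \<Longrightarrow> x \<le> y \<Longrightarrow> y \<le> b \<Longrightarrow> integral {x..y} g = 0"
  shows "AE s in lebesgue. s \<in> {a..b} \<longrightarrow> g s = 0"
proof -
  have "AE s in lebesgue. s \<in> {a..b} \<longrightarrow> g s \<bullet> i = 0" if "i \<in> Basis" for i
  proof (rule AE_zero_of_subinterval_integrals_real)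
    show "(\<lambda>s. g s \<bullet> i) absolutely_integrable_on {a..b}"
      using absolutely_integrable_component[OF ig] .
    show "integral {x..y} (\<lambda>s. g s \<bullet> i) = 0" if "a \<le> x" "x \<le> y" "y \<le> b" for x y
    proof -
      have "g absolutely_integrable_on {x..y}"
        using ig by (rule absolutely_integrable_on_subinterval) (use that in auto)
      then show ?thesis
        using integral_component_eq[of g "{x..y}" i] z[OF that]
        by (simp add: absolutely_integrable_on_def)
    qed
  qed
  then have "AE s in lebesgue. \<forall>i\<in>Basis. s \<in> {a..b} \<longrightarrow> g s \<bullet> i = 0"
    by (subst AE_finite_all) auto
  then show ?thesis
    by (rule eventually_mono) (auto simp: euclidean_all_zero_iff)
qed

lemma weak_derivative_unique:
  fixes u g h :: "real \<Rightarrow> 'a::euclidean_space"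
  assumes "abs_cont_on_interval a b u" "has_weak_derivative a b u g" "has_weak_derivative a b u h"
  shows "AE s in lebesgue. s \<in> {a..b} \<longrightarrow> g s = h s"
proof -
  have i: "g absolutely_integrable_on {a..b}" "h absolutely_integrable_on {a..b}"
    using assms by (auto simp: has_weak_derivative_def absolutely_integrable_on_Icc_iff_Ioo)
  have "AE s in lebesgue. s \<in> {a..b} \<longrightarrow> g s - h s = 0"
  proof (rule AE_zero_of_subinterval_integrals)
    show "(\<lambda>s. g s - h s) absolutely_integrable_on {a..b}" using i by (rule set_integral_diff)
    fix x y assume xy: "a \<le> x" "x \<le> y" "y \<le> b"
    have "g integrable_on {x..y}" "h integrable_on {x..y}"
      using i xy by (auto simp: absolutely_integrable_on_def intro: integrable_on_subinterval)
    then show "integral {x..y} (\<lambda>s. g s - h s) = 0"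
      using weak_derivative_FTC[OF assms(2,1) xy] weak_derivative_FTC[OF assms(3,1) xy]
      by (simp add: Henstock_Kurzweil_Integration.integral_diff)
  qed
  then show ?thesis by simp
qed

section \<open>Indefinite integrals are Sobolev functions\<close>

text \<open>
  Together with the trivial bound on the part of \<open>norm g\<close> below \<open>N\<close>, this yields the absolute
  continuity of the integral.
\<close>

lemma small_tail_integral:
  fixes g :: "real \<Rightarrow> 'a::euclidean_space"
  assumes "g absolutely_integrable_on {a..b}" "e > 0"
  obtains N where "N \<ge> 0" "(\<lambda>s. max (norm (g s) - N) 0) integrable_on {a..b}"
    "integral {a..b} (\<lambda>s. max (norm (g s) - N) 0) < e"
proof -
  let ?f = "\<lambda>k s. max (norm (g s) - real k) 0"
  have ng: "(\<lambda>s. norm (g s)) absolutely_integrable_on {a..b}"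
    using assms(1) by (rule absolutely_integrable_norm[unfolded o_def])
  have int: "?f k integrable_on {a..b}" for k
    by (intro set_lebesgue_integral_eq_integral(1) absolutely_integrable_max_1 set_integral_diff ng)
      auto
  have "(\<lambda>k. integral {a..b} (?f k)) \<longlonglongrightarrow> integral {a..b} (\<lambda>s. 0)"
  proof (rule dominated_convergence(2)[OF int])
    show "(\<lambda>s. norm (g s)) integrable_on {a..b}" using assms(1) by (simp add: absolutely_integrable_on_def)
    show "(\<lambda>k. ?f k s) \<longlonglongrightarrow> 0" for s
    proof (rule tendsto_eventually)
      obtain n :: nat where "norm (g s) \<le> real n" using real_arch_simple by blast
      then show "\<forall>\<^sub>F k in sequentially. ?f k s = 0"
        by (auto simp: eventually_sequentially max_def intro!: exI[of _ n])
    qed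
  qed auto
  then have "\<forall>\<^sub>F k in sequentially. integral {a..b} (?f k) < e"
    using assms(2) by (auto dest: order_tendstoD(2))
  then obtain k where "integral {a..b} (?f k) < e" by (auto simp: eventually_sequentially)
  then show thesis using that[of "real k"] int by auto
qed

lemma indefinite_integral_abs_cont:
  fixes u g :: "real \<Rightarrow> 'a::euclidean_space"
  assumes ig: "g absolutely_integrable_on {a..b}"
    and u: "\<And>s. s \<in> {a..b} \<Longrightarrow> u s = A + integral {a..s} g"
  shows "abs_cont_on_interval a b u"
  unfolding abs_cont_on_interval_def
proof (intro allI impI)
  fix e :: real assume "e > 0"
  then obtain N where N: "N \<ge> 0" "(\<lambda>s. max (norm (g s) - N) 0) integrable_on {a..b}"
    "integral {a..b} (\<lambda>s. max (norm (g s) - N) 0) < e / 2"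
    using small_tail_integral[OF ig, of "e / 2"] by auto
  define h where "h s = max (norm (g s) - N) 0" for s
  have h: "h integrable_on {a..b}" "integral {a..b} h < e / 2" "\<And>s. h s \<ge> 0"
    using N by (auto simp: h_def[abs_def])
  define \<delta> where "\<delta> = e / (2 * (N + 1))"
  show "\<exists>\<delta>>0. \<forall>\<D> S. \<D> division_of S \<and> S \<subseteq> {a..b} \<and> (\<Sum>K\<in>\<D>. Sup K - Inf K) < \<delta> \<longrightarrow>
      (\<Sum>K\<in>\<D>. norm (u (Sup K) - u (Inf K))) < e"
  proof (intro exI[of _ \<delta>] conjI allI impI; (elim conjE)?)
    show "\<delta> > 0" using \<open>e > 0\<close> N by (simp add: \<delta>_def)
    fix \<D> :: "real set set" and S
    assume D: "\<D> division_of S" and S: "S \<subseteq> {a..b}" and len: "(\<Sum>K\<in>\<D>. Sup K - Inf K) < \<delta>"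
    have K: "h integrable_on K \<and> norm (u (Sup K) - u (Inf K)) \<le> integral K h + N * (Sup K - Inf K)" if KD: "K \<in> \<D>" for K
    proof -
      obtain p q where K: "K = {p..q}" using division_ofD(4)[OF D KD] by (metis box_real(2))
      moreover have "K \<noteq> {}" "K \<subseteq> {a..b}" using division_ofD(2,3)[OF D KD] S by auto
      ultimately have pq: "K = {p..q}" "p \<le> q" "a \<le> p" "q \<le> b" by auto
      have gpq: "g integrable_on {p..q}" "g integrable_on {a..q}" "(\<lambda>s. norm (g s)) integrable_on {p..q}"
        using ig pq by (auto simp: absolutely_integrable_on_def intro: integrable_on_subinterval)
      have hpq: "h integrable_on {p..q}"
        using h(1) by (rule integrable_on_subinterval) (use pq in auto)
      have "u q - u p = integral {p..q} g"
        using u[of q] u[of p] pq Henstock_Kurzweil_Integration.integral_combine[of a p q g] gpq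
        by (auto simp: algebra_simps)
      also have "norm \<dots> \<le> integral {p..q} (\<lambda>s. h s + N)"
        by (rule integral_norm_bound_integral) (use gpq(1) in \<open>auto simp: h_def[symmetric] intro!: integrable_add hpq, simp add: h_def\<close>)
      also have "\<dots> = integral {p..q} h + N * (q - p)"
        using hpq pq by (subst Henstock_Kurzweil_Integration.integral_add) auto
      finally show ?thesis using pq hpq by simp
    qed
    have hS: "h integrable_on S"
      by (rule integrable_combine_division[OF D]) (use K in auto)
    have "(\<Sum>K\<in>\<D>. norm (u (Sup K) - u (Inf K))) \<le> (\<Sum>K\<in>\<D>. integral K h + N * (Sup K - Inf K))"
      by (rule sum_mono) (use K in auto)
    also have "\<dots> = integral S h + N * (\<Sum>K\<in>\<D>. Sup K - Inf K)"
      by (simp add: sum.distrib sum_distrib_left integral_combine_division_topdown[OF hS D])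
    also have "\<dots> \<le> integral {a..b} h + N * \<delta>"
      using integral_subset_le[OF S hS h(1)] h(3) len N(1)
      by (intro add_mono mult_left_mono) auto
    also have "N * \<delta> \<le> e / 2"
      using N(1) \<open>e > 0\<close> by (auto simp: \<delta>_def field_simps)
    finally show "(\<Sum>K\<in>\<D>. norm (u (Sup K) - u (Inf K))) < e" using h(2) by linarith
  qed
qed

text \<open>
  Both sides are the integral of \<open>D s * G r\<close> over the triangle \<open>r \<le> s\<close>.
\<close>

lemma triangle_Fubini:
  fixes G :: "real \<Rightarrow> 'a::euclidean_space" and D :: "real \<Rightarrow> real"
  assumes D: "integrable lebesgue D" and G: "integrable lebesgue G"
  shows "(\<integral>s. D s *\<^sub>R (\<integral>r. indicator {..s} r *\<^sub>R G r \<partial>lebesgue) \<partial>lebesgue)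
       = (\<integral>r. (\<integral>s. indicator {r..} s *\<^sub>R D s \<partial>lebesgue) *\<^sub>R G r \<partial>lebesgue)"
proof -
  interpret sigma_finite_measure "lebesgue :: real measure" by (rule sigma_finite_lebesgue)
  interpret pair_sigma_finite "lebesgue :: real measure" "lebesgue :: real measure" ..
  note [measurable] = borel_measurable_integrable[OF D] borel_measurable_integrable[OF G]
  have [measurable]: "(\<lambda>s. s) \<in> lebesgue \<rightarrow>\<^sub>M (borel :: real measure)"
    by (simp add: measurable_completion)
  let ?f = "\<lambda>s r. (if r \<le> s then D s *\<^sub>R G r else 0)"
  have [measurable]: "case_prod ?f \<in> borel_measurable (lebesgue \<Otimes>\<^sub>M lebesgue)"
    by measurable
  have i2: "integrable lebesgue (\<lambda>r. ?f s r)" for s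
    by (rule Bochner_Integration.integrable_bound[of _ "\<lambda>r. D s *\<^sub>R G r"]) (use G in auto)
  have "integrable (lebesgue \<Otimes>\<^sub>M lebesgue) (case_prod ?f)"
  proof (rule Fubini_integrable)
    show "integrable lebesgue (\<lambda>s. \<integral>r. norm (case_prod ?f (s, r)) \<partial>lebesgue)"
    proof (rule Bochner_Integration.integrable_bound)
      show "integrable lebesgue (\<lambda>s. D s * (\<integral>r. norm (G r) \<partial>lebesgue))" using D by simp
      show "AE s in lebesgue. norm (\<integral>r. norm (case_prod ?f (s, r)) \<partial>lebesgue) \<le> norm (D s * (\<integral>r. norm (G r) \<partial>lebesgue))"
      proof (rule AE_I2)
        fix s
        have "(\<integral>r. norm (case_prod ?f (s, r)) \<partial>lebesgue) \<le> (\<integral>r. \<bar>D s\<bar> * norm (G r) \<partial>lebesgue)"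
          by (rule integral_mono) (use i2[of s] G in \<open>auto intro!: integrable_norm\<close>)
        then show "norm (\<integral>r. norm (case_prod ?f (s, r)) \<partial>lebesgue) \<le> norm (D s * (\<integral>r. norm (G r) \<partial>lebesgue))"
          by (simp add: abs_mult)
      qed
    qed measurable
  qed (use i2 in auto)
  from Fubini_integral[OF this]
  have "(\<integral>s. (\<integral>r. ?f s r \<partial>lebesgue) \<partial>lebesgue) = (\<integral>r. (\<integral>s. ?f s r \<partial>lebesgue) \<partial>lebesgue)" by simp
  moreover have "(\<integral>r. ?f s r \<partial>lebesgue) = D s *\<^sub>R (\<integral>r. indicator {..s} r *\<^sub>R G r \<partial>lebesgue)" for s
    unfolding integral_scaleR_right[symmetric]
    by (intro Bochner_Integration.integral_cong) (auto simp: indicator_def)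
  moreover have "(\<integral>s. ?f s r \<partial>lebesgue) = (\<integral>s. indicator {r..} s *\<^sub>R D s \<partial>lebesgue) *\<^sub>R G r" for r
  proof -
    have "integrable lebesgue (\<lambda>s. indicator {r..} s *\<^sub>R D s)"
      by (rule Bochner_Integration.integrable_bound[OF D]) (auto simp: indicator_def)
    then have "(\<integral>s. indicator {r..} s *\<^sub>R D s \<partial>lebesgue) *\<^sub>R G r
        = (\<integral>s. (indicator {r..} s *\<^sub>R D s) *\<^sub>R G r \<partial>lebesgue)"
      by (intro integral_scaleR_left[symmetric])
    also have "\<dots> = (\<integral>s. ?f s r \<partial>lebesgue)"
      by (intro Bochner_Integration.integral_cong) (auto simp: indicator_def)
    finally show ?thesis ..
  qed
  ultimately show ?thesis by simp
qed

text \<open>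
  Integration by parts against a test function, proved by exchanging the order of integration:
  the inner integral of \<open>deriv \<phi>\<close> over \<open>{r..b}\<close> is \<open>- \<phi> r\<close>, as \<open>\<phi>\<close> vanishes at \<open>b\<close>.
\<close>

lemma indefinite_integral_weak_derivative:
  fixes u g :: "real \<Rightarrow> 'a::euclidean_space"
  assumes ig: "g absolutely_integrable_on {a..b}"
    and u: "\<And>s. s \<in> {a..b} \<Longrightarrow> u s = A + integral {a..s} g"
    and ab: "a < b"
  shows "has_weak_derivative a b u g"
proof -
  have cu: "continuous_on {a..b} u"
    by (intro abs_cont_on_interval_continuous indefinite_integral_abs_cont[OF ig u])
  have "(LINT s:{a<..<b}|lebesgue. deriv \<phi> s *\<^sub>R u s) = - (LINT s:{a<..<b}|lebesgue. \<phi> s *\<^sub>R g s)"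
    if \<phi>: "test_function {a<..<b} \<phi>" for \<phi>
  proof -
    have d: "(\<phi> has_real_derivative deriv \<phi> s) (at s)" for s
      using \<phi> unfolding test_function_def by (metis DERIV_deriv_iff_real_differentiable funpow_0)
    have c: "continuous_on X \<phi>" for X
      using d DERIV_isCont continuous_at_imp_continuous_on by blast
    have "deriv \<phi> differentiable at s" for s
      using \<phi> unfolding test_function_def by (metis One_nat_def funpow_0 funpow.simps(2) comp_apply)
    then have c': "continuous_on X (deriv \<phi>)" for X
      by (meson differentiable_at_imp_differentiable_on differentiable_imp_continuous_on)
    have "{s. \<phi> s \<noteq> 0} \<subseteq> {a<..<b}"
      using \<phi> unfolding test_function_def by (meson closure_subset subset_trans)
    then have "a \<notin> {s. \<phi> s \<noteq> 0}" "b \<notin> {s. \<phi> s \<noteq> 0}"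
      by (metis greaterThanLessThan_iff less_irrefl subsetD)+
    then have z: "\<phi> a = 0" "\<phi> b = 0" by simp_all
    have hd: "(deriv \<phi> has_integral \<phi> q - \<phi> p) {p..q}" if "p \<le> q" for p q
      using that d by (intro fundamental_theorem_of_calculus)
        (auto simp: has_real_derivative_iff_has_vector_derivative[symmetric] intro: has_field_derivative_at_within)
    let ?G = "\<lambda>s. indicator {a..b} s *\<^sub>R g s" and ?D = "\<lambda>s. indicator {a..b} s *\<^sub>R deriv \<phi> s"
    have G: "integrable lebesgue ?G" using ig by (simp add: set_integrable_def)
    have cD: "deriv \<phi> absolutely_integrable_on {p..q}" for p q
      by (intro absolutely_integrable_continuous_real c')
    then have D: "integrable lebesgue ?D" by (simp add: set_integrable_def)
    have 1: "(\<integral>s. ?D s *\<^sub>R (\<integral>r. indicator {..s} r *\<^sub>R ?G r \<partial>lebesgue) \<partial>lebesgue)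
      = (LINT s:{a..b}|lebesgue. deriv \<phi> s *\<^sub>R (u s - A))"
      unfolding set_lebesgue_integral_def
    proof (rule Bochner_Integration.integral_cong[OF refl])
      fix s :: real
      have "(\<integral>r. indicator {..s} r *\<^sub>R ?G r \<partial>lebesgue) = u s - A" if s: "s \<in> {a..b}"
      proof -
        have "(\<integral>r. indicator {..s} r *\<^sub>R ?G r \<partial>lebesgue) = (LINT r:{a..s}|lebesgue. g r)"
          unfolding set_lebesgue_integral_def using s
          by (intro Bochner_Integration.integral_cong) (auto simp: indicator_def)
        also have "\<dots> = integral {a..s} g"
          by (rule set_lebesgue_integral_eq_integral) (rule set_integrable_subset[OF ig], use s in auto)
        finally show ?thesis using u[OF s] by simp
      qed
      then show "?D s *\<^sub>R (\<integral>r. indicator {..s} r *\<^sub>R ?G r \<partial>lebesgue)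
        = indicator {a..b} s *\<^sub>R deriv \<phi> s *\<^sub>R (u s - A)"
        by (auto simp: indicator_def)
    qed
    have 2: "(\<integral>r. (\<integral>s. indicator {r..} s *\<^sub>R ?D s \<partial>lebesgue) *\<^sub>R ?G r \<partial>lebesgue)
      = - (LINT r:{a..b}|lebesgue. \<phi> r *\<^sub>R g r)"
      unfolding set_lebesgue_integral_def Bochner_Integration.integral_minus[symmetric]
    proof (rule Bochner_Integration.integral_cong[OF refl])
      fix r :: real
      have "(\<integral>s. indicator {r..} s *\<^sub>R ?D s \<partial>lebesgue) = - \<phi> r" if r: "r \<in> {a..b}"
      proof -
        have "(\<integral>s. indicator {r..} s *\<^sub>R ?D s \<partial>lebesgue) = (LINT s:{r..b}|lebesgue. deriv \<phi> s)"
          unfolding set_lebesgue_integral_def using r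
          by (intro Bochner_Integration.integral_cong) (auto simp: indicator_def)
        also have "\<dots> = integral {r..b} (deriv \<phi>)"
          by (rule set_lebesgue_integral_eq_integral) (rule cD)
        also have "\<dots> = - \<phi> r" using hd[of r b] r z by (simp add: integral_unique)
        finally show ?thesis .
      qed
      then show "(\<integral>s. indicator {r..} s *\<^sub>R ?D s \<partial>lebesgue) *\<^sub>R ?G r
        = - (indicator {a..b} r *\<^sub>R \<phi> r *\<^sub>R g r)"
        by (auto simp: indicator_def)
    qed
    have ioo: "(LINT s:{a<..<b}|lebesgue. f s) = integral {a..b} f" "(LINT s:{a..b}|lebesgue. f s) = integral {a..b} f"
      if "f absolutely_integrable_on {a..b}" for f :: "real \<Rightarrow> 'a"
      using that set_lebesgue_integral_eq_integral(2)[of "{a<..<b}" f] set_lebesgue_integral_eq_integral(2)[of "{a..b}" f]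
      by (auto simp: absolutely_integrable_on_Icc_iff_Ioo integral_open_interval_real)
    have du: "(\<lambda>s. deriv \<phi> s *\<^sub>R u s) absolutely_integrable_on {a..b}"
      "(\<lambda>s. deriv \<phi> s *\<^sub>R (u s - A)) absolutely_integrable_on {a..b}"
      by (intro absolutely_integrable_continuous_real continuous_intros c' cu)+
    have "((\<lambda>s. deriv \<phi> s *\<^sub>R A) has_integral 0) {a..b}"
      using has_integral_scaleR_left[OF hd[of a b], of A] ab z by simp
    then have "integral {a..b} (\<lambda>s. deriv \<phi> s *\<^sub>R (u s - A)) = integral {a..b} (\<lambda>s. deriv \<phi> s *\<^sub>R u s)"
      using has_integral_diff[OF integrable_integral[OF set_lebesgue_integral_eq_integral(1)[OF du(1)]], of "\<lambda>s. deriv \<phi> s *\<^sub>R A" 0]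
      by (simp add: scaleR_diff_right integral_unique)
    then show ?thesis
      using triangle_Fubini[OF D G] 1 2 ioo(1)[OF du(1)] ioo(2)[OF du(2)]
        ioo[OF continuous_scaleR_absolutely_integrable[OF c ig]] by simp
  qed
  then show ?thesis
    using absolutely_integrable_continuous_real[OF cu] ig
    by (simp add: has_weak_derivative_def absolutely_integrable_on_Icc_iff_Ioo)
qed

text \<open>
  The source of competitors: prescribing an integrable derivative produces a Sobolev function, and
  the chosen version of its weak derivative can be replaced by the prescribed one.
\<close>

lemma indefinite_integral_W11:
  fixes u g :: "real \<Rightarrow> 'a::euclidean_space"
  assumes "g absolutely_integrable_on {a..b}" "\<And>s. s \<in> {a..b} \<Longrightarrow> u s = A + integral {a..s} g" "a < b"
  shows "u \<in> W11 a b" and "AE s in lebesgue. s \<in> {a..b} \<longrightarrow> weak_derivative a b u s = g s"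
proof -
  have ac: "abs_cont_on_interval a b u" and wd: "has_weak_derivative a b u g"
    using indefinite_integral_abs_cont[OF assms(1,2)] indefinite_integral_weak_derivative[OF assms] by auto
  then have W: "u \<in> W11 a b" "has_weak_derivative a b u (weak_derivative a b u)"
    unfolding weak_derivative_def W11_def by (auto intro: someI[of "has_weak_derivative a b u" g])
  then show "u \<in> W11 a b" "AE s in lebesgue. s \<in> {a..b} \<longrightarrow> weak_derivative a b u s = g s"
    using weak_derivative_unique[OF ac W(2) wd] by auto
qed

section \<open>Finiteness of the energy and comparison with chords\<close>

lemma W11_weak_derivative:
  assumes "u \<in> W11 a b"
  shows "abs_cont_on_interval a b u" "continuous_on {a..b} u"
    "has_weak_derivative a b u (weak_derivative a b u)"
    "weak_derivative a b u absolutely_integrable_on {a..b}"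
proof -
  from assms obtain g where g: "abs_cont_on_interval a b u" "has_weak_derivative a b u g"
    by (auto simp: W11_def)
  show "abs_cont_on_interval a b u" "continuous_on {a..b} u"
    using g abs_cont_on_interval_continuous by auto
  show *: "has_weak_derivative a b u (weak_derivative a b u)"
    unfolding weak_derivative_def using g(2) by (rule someI[of "has_weak_derivative a b u"])
  show "weak_derivative a b u absolutely_integrable_on {a..b}"
    using * by (simp add: has_weak_derivative_def absolutely_integrable_on_Icc_iff_Ioo)
qed

lemma convex_on_of_subgradients:
  fixes f :: "'a::real_inner \<Rightarrow> real"
  assumes "\<And>p. \<exists>\<xi>. subgradient f p \<xi>"
  shows "convex_on UNIV f"
proof (rule convex_onI)
  fix \<mu> :: real and x y :: 'a
  assume \<mu>: "0 < \<mu>" "\<mu> < 1"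
  let ?z = "(1 - \<mu>) *\<^sub>R x + \<mu> *\<^sub>R y"
  obtain \<xi> where \<xi>: "\<And>q. f q \<ge> f ?z + \<xi> \<bullet> (q - ?z)"
    using assms unfolding subgradient_def by blast
  have "(1 - \<mu>) * (f ?z + \<xi> \<bullet> (x - ?z)) + \<mu> * (f ?z + \<xi> \<bullet> (y - ?z)) \<le> (1 - \<mu>) * f x + \<mu> * f y"
    using \<mu> \<xi> by (intro add_mono mult_left_mono) auto
  moreover have "(1 - \<mu>) * (f ?z + \<xi> \<bullet> (x - ?z)) + \<mu> * (f ?z + \<xi> \<bullet> (y - ?z)) = f ?z"
    by (simp add: inner_diff_right inner_add_right algebra_simps)
  ultimately show "f ?z \<le> (1 - \<mu>) * f x + \<mu> * f y" by simp
qed simp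

lemma strict_convexity_SC_convex:
  fixes L :: "real \<Rightarrow> 'a::real_inner \<Rightarrow> 'a \<Rightarrow> real"
  assumes "strict_convexity_SC a b L" "s \<in> {a..b}"
  shows "convex_on UNIV (L s y)"
proof (rule convex_on_of_subgradients)
  fix p :: 'a
  let ?R = "max 1 (Max {\<bar>s\<bar>, norm y, norm p})"
  have "Max {\<bar>s\<bar>, norm y, norm p} \<le> ?R + 1" by linarith
  then show "\<exists>\<xi>. subgradient (L s y) p \<xi>"
    using assms unfolding strict_convexity_SC_def by (metis max.cobounded1)
qed

text \<open>
  Convexity along the segment from \<open>0\<close> to \<open>q\<close> shows that \<open>f\<close> cannot fall faster than linearly beyond
  the unit sphere.
\<close>

lemma convex_linear_lower_bound:
  fixes f :: "'a::real_normed_vector \<Rightarrow> real"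
  assumes conv: "convex_on UNIV f" and K: "\<And>q. norm q \<le> 1 \<Longrightarrow> \<bar>f q\<bar> \<le> K"
  shows "f q \<ge> - (2 * K) * (1 + norm q)"
proof -
  have K0: "K \<ge> 0" using K[of 0] by simp
  show ?thesis
  proof (cases "norm q \<le> 1")
    case True
    have "2 * K * (1 + norm q) \<ge> 2 * K * 1" using K0 by (intro mult_left_mono) auto
    with K[OF True] show ?thesis using K0 by linarith
  next
    case False
    define m where "m = norm q"
    have m: "m > 1" using False by (simp add: m_def)
    have "f ((1 - 1 / m) *\<^sub>R 0 + (1 / m) *\<^sub>R q) \<le> (1 - 1 / m) * f 0 + (1 / m) * f q"
      by (rule convex_onD[OF conv]) (use m in auto)
    moreover have "norm ((1 / m) *\<^sub>R q) \<le> 1" using m unfolding norm_scaleR m_def[symmetric] by simp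
    from K[OF this] have "- K \<le> f ((1 / m) *\<^sub>R q)" by linarith
    moreover have "f 0 \<le> K" using K[of 0] by simp
    moreover have "(1 - 1 / m) * f 0 \<le> (1 - 1 / m) * K"
      using \<open>f 0 \<le> K\<close> m by (intro mult_left_mono) auto
    ultimately have "- K \<le> (1 - 1 / m) * K + (1 / m) * f q" by simp
    then have "- K * m \<le> (m - 1) * K + f q"
      using m by (simp add: field_simps)
    then show ?thesis using K0 by (simp add: m_def[symmetric] algebra_simps)
  qed
qed

text \<open>
  The constant is uniform because \<open>L\<close> is bounded on the compact set
  \<open>{a..b} \<times> cball 0 M \<times> cball 0 1\<close>. It is what makes the negative part of the energy finite.
\<close>

lemma Lagrangian_linear_lower_bound:
  fixes L :: "real \<Rightarrow> 'a::euclidean_space \<Rightarrow> 'a \<Rightarrow> real"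
  assumes contL: "continuous_on ({a..b} \<times> UNIV \<times> UNIV) (\<lambda>(t, y, p). L t y p)"
    and conv: "\<And>s y. s \<in> {a..b} \<Longrightarrow> convex_on UNIV (L s y)"
  obtains C where "C \<ge> 0" "\<And>s y q. s \<in> {a..b} \<Longrightarrow> norm y \<le> M \<Longrightarrow> L s y q \<ge> - C * (1 + norm q)"
proof -
  let ?S = "{a..b} \<times> cball 0 M \<times> cball (0::'a) 1"
  have "continuous_on ?S (\<lambda>(t, y, p). L t y p)"
    using contL by (rule continuous_on_subset) auto
  then have "bounded ((\<lambda>(t, y, p). L t y p) ` ?S)"
    by (intro compact_imp_bounded compact_continuous_image compact_Times) auto
  then obtain K where K: "K > 0" "\<forall>x\<in>?S. norm ((\<lambda>(t, y, p). L t y p) x) \<le> K"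
    by (auto simp: bounded_pos)
  have "L s y q \<ge> - (2 * K) * (1 + norm q)" if s: "s \<in> {a..b}" and y: "norm y \<le> M" for s y q
  proof (rule convex_linear_lower_bound)
    show "convex_on UNIV (L s y)" using s by (rule conv)
    show "\<bar>L s y q\<bar> \<le> K" if "norm q \<le> 1" for q
      using K(2)[rule_format, of "(s, y, q)"] s y that by auto
  qed
  then show thesis using that[of "2 * K"] K by auto
qed

lemma Lagrangian_measurable:
  fixes L :: "real \<Rightarrow> 'a::euclidean_space \<Rightarrow> 'a \<Rightarrow> real"
  assumes contL: "continuous_on ({a..b} \<times> UNIV \<times> UNIV) (\<lambda>(t, y, p). L t y p)"
    and cu: "continuous_on {a..b} u" and h: "h absolutely_integrable_on {a..b}"
  shows "(\<lambda>s. indicator {a..b} s *\<^sub>R L s (u s) (h s)) \<in> borel_measurable lebesgue"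
proof -
  have "(\<lambda>s. s) \<in> borel_measurable (lebesgue_on {a..b})"
    by (intro continuous_imp_measurable_on_sets_lebesgue continuous_intros) auto
  moreover have "u \<in> borel_measurable (lebesgue_on {a..b})"
    using cu by (intro continuous_imp_measurable_on_sets_lebesgue) auto
  moreover have "h \<in> borel_measurable (lebesgue_on {a..b})"
    using h by (rule absolutely_integrable_imp_borel_measurable) auto
  ultimately have "(\<lambda>s. (s, u s, h s)) \<in> borel_measurable (lebesgue_on {a..b})"
    by (intro borel_measurable_Pair)
  then have "(\<lambda>s. (s, u s, h s)) \<in> lebesgue_on {a..b} \<rightarrow>\<^sub>M restrict_space borel ({a..b} \<times> UNIV \<times> UNIV)"
    by (intro measurable_restrict_space2) (auto simp: space_restrict_space)
  then have "(\<lambda>s. (\<lambda>(t, y, p). L t y p) (s, u s, h s)) \<in> borel_measurable (lebesgue_on {a..b})"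
    by (rule measurable_compose[OF _ borel_measurable_continuous_on_restrict[OF contL]])
  then show ?thesis
    by (simp add: borel_measurable_restrict_space_iff)
qed

lemma energy_eq_parts:
  fixes L :: "real \<Rightarrow> 'a::euclidean_space \<Rightarrow> 'a \<Rightarrow> real"
  assumes "AE s in lebesgue. s \<in> {a..b} \<longrightarrow> weak_derivative a b u s = h s"
  shows "energy a b L u =
    enn2ereal (\<integral>\<^sup>+s. ennreal (indicator {a..b} s *\<^sub>R L s (u s) (h s)) \<partial>lebesgue)
    - enn2ereal (\<integral>\<^sup>+s. ennreal (- (indicator {a..b} s *\<^sub>R L s (u s) (h s))) \<partial>lebesgue)"
proof -
  have ne: "AE s in lebesgue. s \<noteq> a \<and> s \<noteq> b"
    by (rule AE_completion) (auto intro: AE_lborel_singleton)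
  have "(\<integral>\<^sup>+s\<in>{a<..<b}. ennreal (L s (u s) (weak_derivative a b u s)) \<partial>lebesgue)
     = (\<integral>\<^sup>+s. ennreal (indicator {a..b} s *\<^sub>R L s (u s) (h s)) \<partial>lebesgue)"
    by (rule nn_integral_cong_AE) (use assms ne in eventually_elim, auto simp: indicator_def)
  moreover have "(\<integral>\<^sup>+s\<in>{a<..<b}. ennreal (- L s (u s) (weak_derivative a b u s)) \<partial>lebesgue)
     = (\<integral>\<^sup>+s. ennreal (- (indicator {a..b} s *\<^sub>R L s (u s) (h s))) \<partial>lebesgue)"
    by (rule nn_integral_cong_AE) (use assms ne in eventually_elim, auto simp: indicator_def)
  ultimately show ?thesis by (simp add: energy_def)
qed

lemma energy_eq_integral:
  fixes L :: "real \<Rightarrow> 'a::euclidean_space \<Rightarrow> 'a \<Rightarrow> real"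
  assumes "AE s in lebesgue. s \<in> {a..b} \<longrightarrow> weak_derivative a b u s = h s"
    and int: "(\<lambda>s. L s (u s) (h s)) absolutely_integrable_on {a..b}"
  shows "energy a b L u = ereal (integral {a..b} (\<lambda>s. L s (u s) (h s)))"
proof -
  let ?f = "\<lambda>s. indicator {a..b} s *\<^sub>R L s (u s) (h s)"
  have f: "integrable lebesgue ?f" using int by (simp add: set_integrable_def)
  have "(\<integral>\<^sup>+s. ennreal (?f s) \<partial>lebesgue) \<noteq> \<infinity>" "(\<integral>\<^sup>+s. ennreal (- ?f s) \<partial>lebesgue) \<noteq> \<infinity>"
    using f unfolding real_integrable_def by auto
  then have "energy a b L u = ereal (enn2real (\<integral>\<^sup>+s. ennreal (?f s) \<partial>lebesgue) - enn2real (\<integral>\<^sup>+s. ennreal (- ?f s) \<partial>lebesgue))"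
    unfolding energy_eq_parts[OF assms(1)]
    by (cases "\<integral>\<^sup>+s. ennreal (?f s) \<partial>lebesgue"; cases "\<integral>\<^sup>+s. ennreal (- ?f s) \<partial>lebesgue") auto
  also have "\<dots> = ereal (integral\<^sup>L lebesgue ?f)" unfolding real_lebesgue_integral_def[OF f] ..
  also have "integral\<^sup>L lebesgue ?f = integral {a..b} (\<lambda>s. L s (u s) (h s))"
    using set_lebesgue_integral_eq_integral(2)[OF int] by (simp add: set_lebesgue_integral_def)
  finally show ?thesis .
qed

text \<open>
  The negative part is dominated by a multiple of \<open>1 + norm (weak_derivative a b u s)\<close>, so a finite
  energy bounds the positive part as well.
\<close>

lemma finite_energy_integrable:
  fixes L :: "real \<Rightarrow> 'a::euclidean_space \<Rightarrow> 'a \<Rightarrow> real"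
  assumes contL: "continuous_on ({a..b} \<times> UNIV \<times> UNIV) (\<lambda>(t, y, p). L t y p)"
    and conv: "\<And>s y. s \<in> {a..b} \<Longrightarrow> convex_on UNIV (L s y)"
    and u: "u \<in> W11 a b" and fin: "energy a b L u < \<infinity>"
  shows "(\<lambda>s. L s (u s) (weak_derivative a b u s)) absolutely_integrable_on {a..b}"
proof -
  let ?h = "weak_derivative a b u"
  let ?f = "\<lambda>s. indicator {a..b} s *\<^sub>R L s (u s) (?h s)"
  note W = W11_weak_derivative[OF u]
  have meas: "?f \<in> borel_measurable lebesgue" by (rule Lagrangian_measurable[OF contL W(2,4)])
  obtain M where M: "\<And>s. s \<in> {a..b} \<Longrightarrow> norm (u s) \<le> M"
    using compact_imp_bounded[OF compact_continuous_image[OF W(2) compact_Icc]]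
    unfolding bounded_iff by (metis imageI)
  obtain C where C: "C \<ge> 0" "\<And>s y q. s \<in> {a..b} \<Longrightarrow> norm y \<le> M \<Longrightarrow> L s y q \<ge> - C * (1 + norm q)"
    using Lagrangian_linear_lower_bound[OF contL conv] by metis
  let ?g = "\<lambda>s. indicator {a..b} s *\<^sub>R (C * (1 + norm (?h s)))"
  have g: "integrable lebesgue ?g"
  proof -
    have "(\<lambda>s. norm (?h s)) absolutely_integrable_on {a..b}"
      using W(4) by (rule absolutely_integrable_norm[unfolded o_def])
    then have "(\<lambda>s. C * (1 + norm (?h s))) absolutely_integrable_on {a..b}"
      by (intro set_integrable_mult_right set_integral_add) auto
    then show ?thesis by (simp add: set_integrable_def)
  qed
  have "(\<integral>\<^sup>+s. ennreal (- ?f s) \<partial>lebesgue) \<le> (\<integral>\<^sup>+s. ennreal (?g s) \<partial>lebesgue)"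
  proof (rule nn_integral_mono)
    fix s
    show "ennreal (- ?f s) \<le> ennreal (?g s)"
      using C(2)[of s "u s" "?h s"] M[of s] by (intro ennreal_leI) (auto simp: indicator_def)
  qed
  also have "\<dots> < \<infinity>" using g unfolding real_integrable_def by (simp add: less_top)
  finally have neg: "(\<integral>\<^sup>+s. ennreal (- ?f s) \<partial>lebesgue) < \<infinity>" .
  have "energy a b L u = enn2ereal (\<integral>\<^sup>+s. ennreal (?f s) \<partial>lebesgue) - enn2ereal (\<integral>\<^sup>+s. ennreal (- ?f s) \<partial>lebesgue)"
    by (rule energy_eq_parts) simp
  then have "(\<integral>\<^sup>+s. ennreal (?f s) \<partial>lebesgue) < \<infinity>"
    using fin neg
    by (cases "\<integral>\<^sup>+s. ennreal (?f s) \<partial>lebesgue"; cases "\<integral>\<^sup>+s. ennreal (- ?f s) \<partial>lebesgue") auto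
  then have "integrable lebesgue ?f"
    using meas neg unfolding real_integrable_def by auto
  then show ?thesis by (simp add: set_integrable_def)
qed

lemma absolutely_integrable_modify_on_subinterval:
  fixes f k :: "real \<Rightarrow> 'a::euclidean_space"
  assumes f: "f absolutely_integrable_on {a..b}" and k: "k absolutely_integrable_on {c..d}"
  shows "(\<lambda>s. f s + (if s \<in> {c..d} then k s else 0)) absolutely_integrable_on {a..b}"
    and "integral {a..b} (\<lambda>s. f s + (if s \<in> {c..d} then k s else 0))
      = integral {a..b} f + integral ({c..d} \<inter> {a..b}) k"
proof -
  have k': "(\<lambda>s. if s \<in> {c..d} then k s else 0) absolutely_integrable_on {a..b}"
  proof -
    have "integrable lebesgue (\<lambda>s. indicator {c..d} s *\<^sub>R k s)" using k by (simp add: set_integrable_def)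
    then have "(\<lambda>s. if s \<in> {c..d} then k s else 0) absolutely_integrable_on UNIV"
      by (simp add: set_integrable_def indicator_scaleR_eq_if)
    then show ?thesis by (rule set_integrable_subset) auto
  qed
  show "(\<lambda>s. f s + (if s \<in> {c..d} then k s else 0)) absolutely_integrable_on {a..b}"
    using f k' by (rule set_integral_add)
  show "integral {a..b} (\<lambda>s. f s + (if s \<in> {c..d} then k s else 0))
      = integral {a..b} f + integral ({c..d} \<inter> {a..b}) k"
    using f k' by (subst Henstock_Kurzweil_Integration.integral_add)
      (auto simp: Henstock_Kurzweil_Integration.integral_restrict_Int set_lebesgue_integral_eq_integral(1)
        simp del: Int_atLeastAtMost atLeastAtMost_iff)
qed

text \<open>
  The affine function with the same boundary values has finite energy.
\<close>

lemma minimizer_finite_energy: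
  fixes L :: "real \<Rightarrow> 'a::euclidean_space \<Rightarrow> 'a \<Rightarrow> real"
  assumes contL: "continuous_on ({a..b} \<times> UNIV \<times> UNIV) (\<lambda>(t, y, p). L t y p)"
    and min: "is_minimizer a b L v" and ab: "a < b"
  shows "energy a b L v < \<infinity>"
proof -
  define p where "p = (v b - v a) /\<^sub>R (b - a)"
  define w where "w s = v a + (s - a) *\<^sub>R p" for s
  have w: "w \<in> W11 a b" "AE s in lebesgue. s \<in> {a..b} \<longrightarrow> weak_derivative a b w s = p"
    by (rule indefinite_integral_W11[where g = "\<lambda>_. p" and A = "v a"]; use ab in \<open>auto simp: w_def\<close>)+
  have "w \<in> admissible a b (v a) (v b)"
    using w(1) ab by (simp add: admissible_def w_def p_def)
  then have "energy a b L v \<le> energy a b L w"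
    using min by (simp add: is_minimizer_def)
  also have "energy a b L w = ereal (integral {a..b} (\<lambda>s. L s (w s) p))"
  proof (rule energy_eq_integral[OF w(2)])
    have "continuous_on {a..b} (\<lambda>s. (\<lambda>(t, y, p). L t y p) (s, w s, p))"
      by (rule continuous_on_compose2[OF contL]) (auto simp: w_def intro!: continuous_intros)
    then show "(\<lambda>s. L s (w s) p) absolutely_integrable_on {a..b}"
      by (intro absolutely_integrable_continuous_real) simp
  qed
  finally show ?thesis by auto
qed

text \<open>
  Replacing \<open>v\<close> by its chord on \<open>{c..d}\<close> keeps the boundary values. The energies of \<open>v\<close> and of the
  modified function are finite and differ only by the integrals over \<open>{c..d}\<close>. That the modified
  function is admissible follows by recognising it as the indefinite integral of the weak derivative
  of \<open>v\<close> with its values on \<open>{c..d}\<close> replaced by the constant slope \<open>p\<close>.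
\<close>

lemma minimizer_beats_chord:
  fixes L :: "real \<Rightarrow> 'a::euclidean_space \<Rightarrow> 'a \<Rightarrow> real"
  assumes contL: "continuous_on ({a..b} \<times> UNIV \<times> UNIV) (\<lambda>(t, y, p). L t y p)"
    and conv: "\<And>s y. s \<in> {a..b} \<Longrightarrow> convex_on UNIV (L s y)"
    and min: "is_minimizer a b L v" and cd: "a \<le> c" "c < d" "d \<le> b"
  defines "p \<equiv> (v d - v c) /\<^sub>R (d - c)"
  shows "integral {c..d} (\<lambda>s. L s (v s) (weak_derivative a b v s))
    \<le> integral {c..d} (\<lambda>s. L s (v c + (s - c) *\<^sub>R p) p)"
proof -
  let ?g = "weak_derivative a b v" and ?w = "\<lambda>s. v c + (s - c) *\<^sub>R p"
  define F where "F s = L s (v s) (?g s)" for s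
  define G where "G s = L s (?w s) p" for s
  have vW: "v \<in> W11 a b" using min by (simp add: is_minimizer_def admissible_def)
  note W = W11_weak_derivative[OF vW]
  have FTC: "v y - v x = integral {x..y} ?g" if "a \<le> x" "x \<le> y" "y \<le> b" for x y
    by (rule weak_derivative_FTC[OF W(3,1) that])
  have sub: "{c..d} \<subseteq> {a..b}" using cd by auto
  have F: "F absolutely_integrable_on {a..b}"
    unfolding F_def[abs_def]
    by (rule finite_energy_integrable[OF contL conv vW minimizer_finite_energy[OF contL min]]) (use cd in auto)
  have G: "G absolutely_integrable_on {c..d}"
  proof -
    have "continuous_on {c..d} (\<lambda>s. (\<lambda>(t, y, p). L t y p) (s, ?w s, p))"
      by (rule continuous_on_compose2[OF contL]) (use sub in \<open>auto intro!: continuous_intros\<close>)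
    then show ?thesis unfolding G_def[abs_def]
      by (intro absolutely_integrable_continuous_real) simp
  qed
  have g': "?g absolutely_integrable_on {x..y}" if "a \<le> x" "y \<le> b" for x y
    using W(4) by (rule absolutely_integrable_on_subinterval) (use that in auto)
  have F': "F absolutely_integrable_on {c..d}"
    using F sub by (rule absolutely_integrable_on_subinterval)
  define u where "u s = (if s \<in> {c..d} then ?w s else v s)" for s
  \<comment> \<open>The derivative of the modified function \<open>u\<close>, written as a perturbation of \<open>?g\<close>.\<close>
  define k where "k s = ?g s + (if s \<in> {c..d} then p - ?g s else 0)" for s
  have pg: "(\<lambda>s. p - ?g s) absolutely_integrable_on {c..d}"
    using g'[of c d] cd by (intro set_integral_diff) auto
  have k: "k absolutely_integrable_on {a..b}"
    unfolding k_def[abs_def] by (rule absolutely_integrable_modify_on_subinterval[OF W(4) pg])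
  have u: "u s = v a + integral {a..s} k" if s: "s \<in> {a..b}" for s
  proof -
    have "integral {a..s} k = (v s - v a) + integral ({c..d} \<inter> {a..s}) (\<lambda>s. p - ?g s)"
      unfolding k_def[abs_def]
      using absolutely_integrable_modify_on_subinterval(2)[OF g'[of a s] pg] s FTC[of a s] by simp
    moreover have "integral ({c..d} \<inter> {a..s}) (\<lambda>s. p - ?g s) = u s - v s"
    proof (cases "s < c")
      case True
      then have "{c..d} \<inter> {a..s} = {}" by auto
      then show ?thesis using True by (simp add: u_def)
    next
      case False
      let ?m = "min d s"
      have "{c..d} \<inter> {a..s} = {c..?m}" using cd by auto
      moreover have "integral {c..?m} (\<lambda>s. p - ?g s) = (?m - c) *\<^sub>R p - (v ?m - v c)"
        using False cd s g'[of c ?m] FTC[of c ?m]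
        by (subst Henstock_Kurzweil_Integration.integral_diff) (auto simp: set_lebesgue_integral_eq_integral(1))
      moreover have "(?m - c) *\<^sub>R p - (v ?m - v c) = u s - v s"
        using False cd by (cases "s \<le> d") (auto simp: u_def p_def min_def)
      ultimately show ?thesis by metis
    qed
    ultimately show ?thesis by simp
  qed
  have uW: "u \<in> W11 a b" "AE s in lebesgue. s \<in> {a..b} \<longrightarrow> weak_derivative a b u s = k s"
    using indefinite_integral_W11[OF k u] cd by auto
  have "u a = v a" "u b = v b"
    using cd by (auto simp: u_def p_def)
  then have "energy a b L v \<le> energy a b L u"
    using min uW(1) by (simp add: is_minimizer_def admissible_def)
  moreover have "energy a b L v = ereal (integral {a..b} F)"
    unfolding F_def[abs_def] by (rule energy_eq_integral) (use F in \<open>auto simp: F_def[abs_def]\<close>)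
  moreover have GF: "(\<lambda>s. G s - F s) absolutely_integrable_on {c..d}"
    using G F' by (rule set_integral_diff)
  have Lu: "(\<lambda>s. L s (u s) (k s)) = (\<lambda>s. F s + (if s \<in> {c..d} then G s - F s else 0))"
    by (auto simp: u_def k_def F_def G_def)
  have "energy a b L u = ereal (integral {a..b} (\<lambda>s. L s (u s) (k s)))"
    by (rule energy_eq_integral[OF uW(2)])
      (unfold Lu, rule absolutely_integrable_modify_on_subinterval[OF F GF])
  moreover have "{c..d} \<inter> {a..b} = {c..d}" using sub by auto
  ultimately have "0 \<le> integral {c..d} (\<lambda>s. G s - F s)"
    using absolutely_integrable_modify_on_subinterval(2)[OF F GF]
    by (simp add: Lu del: Int_atLeastAtMost)
  then have "integral {c..d} F \<le> integral {c..d} G"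
    using G F' by (subst (asm) Henstock_Kurzweil_Integration.integral_diff)
      (auto simp: set_lebesgue_integral_eq_integral(1))
  then show ?thesis by (simp add: F_def[abs_def] G_def[abs_def])
qed

section \<open>Strict convexity near a point\<close>

text \<open>
  A gap over a supporting affine function that is visible on the sphere of radius \<open>r\<close> around \<open>p\<close>
  propagates outwards by convexity and grows linearly with the distance. This turns estimates on a
  compact ball, where the perturbation \<open>\<epsilon>\<close> can be controlled, into estimates for all slopes.
\<close>

lemma convex_propagate_strict_gap:
  fixes f :: "'a::real_inner \<Rightarrow> real"
  assumes conv: "convex_on UNIV f" and r: "r > 0" and \<epsilon>: "0 \<le> \<epsilon>" "\<epsilon> \<le> \<tau> / 2"
    and up: "f p \<le> M + \<epsilon>"
    and near: "\<And>q. norm (q - p) \<le> r \<Longrightarrow> f q \<ge> M + \<xi> \<bullet> (q - p) - \<epsilon>"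
    and rim: "\<And>q. norm (q - p) = r \<Longrightarrow> f q \<ge> M + \<xi> \<bullet> (q - p) + 2 * \<tau> - \<epsilon>"
  shows "f q \<ge> M + \<xi> \<bullet> (q - p) - \<epsilon> + \<tau> * (norm (q - p) / r - 1)"
proof (cases "norm (q - p) \<le> r")
  case True
  then have "\<tau> * (norm (q - p) / r - 1) \<le> 0"
    using \<epsilon> r by (intro mult_nonneg_nonpos) (auto simp: divide_le_eq)
  then show ?thesis using near[OF True] by linarith
next
  case False
  \<comment> \<open>The factor by which \<open>q\<close> lies beyond the sphere of radius \<open>r\<close>.\<close>
  define m where "m = norm (q - p) / r"
  have m: "m > 1" using False r by (simp add: m_def less_divide_eq)
  \<comment> \<open>The point where the segment from \<open>p\<close> to \<open>q\<close> meets the sphere of radius \<open>r\<close>.\<close>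
  let ?q = "(1 - 1 / m) *\<^sub>R p + (1 / m) *\<^sub>R q"
  have q: "?q - p = (1 / m) *\<^sub>R (q - p)" by (simp add: algebra_simps)
  have "q \<noteq> p" using False r by auto
  then have "norm (?q - p) = r"
    unfolding q norm_scaleR using r by (simp add: m_def)
  from rim[OF this] have "M + (1 / m) * (\<xi> \<bullet> (q - p)) + 2 * \<tau> - \<epsilon> \<le> f ?q"
    by (simp only: q inner_scaleR_right)
  also have "\<dots> \<le> (1 - 1 / m) * f p + (1 / m) * f q"
    by (rule convex_onD[OF conv]) (use m in auto)
  also have "(1 - 1 / m) * f p \<le> (1 - 1 / m) * (M + \<epsilon>)"
    using m up by (intro mult_left_mono) auto
  finally have "m * (M + (1 / m) * (\<xi> \<bullet> (q - p)) + 2 * \<tau> - \<epsilon>) \<le> m * ((1 - 1 / m) * (M + \<epsilon>) + (1 / m) * f q)"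
    using m by (intro mult_left_mono) auto
  also have "\<dots> = (m - 1) * (M + \<epsilon>) + f q"
    using m by (simp add: field_simps)
  also have "m * (M + (1 / m) * (\<xi> \<bullet> (q - p)) + 2 * \<tau> - \<epsilon>) = m * M + \<xi> \<bullet> (q - p) + m * (2 * \<tau> - \<epsilon>)"
    using m by (simp add: field_simps)
  finally have "f q \<ge> M + \<xi> \<bullet> (q - p) + m * (2 * \<tau> - 2 * \<epsilon>) + \<epsilon>"
    by (simp add: algebra_simps)
  moreover have "m * (2 * \<tau> - 2 * \<epsilon>) \<ge> m * \<tau>" using m \<epsilon> by (intro mult_left_mono) auto
  moreover have "\<tau> * (norm (q - p) / r - 1) = m * \<tau> - \<tau>" by (simp add: m_def algebra_simps)
  ultimately show ?thesis using \<epsilon> by linarith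
qed

text \<open>
  One slope \<open>\<xi>\<close> serves for all \<open>(s, y)\<close> near \<open>(t, y0)\<close>: it is a subgradient at the centre, and
  uniform continuity of \<open>L\<close> on a compact neighbourhood keeps the affine lower bound and the gap on the
  sphere of radius \<open>r\<close> up to \<open>\<tau>/4\<close>. In the first bound the last summand is nonpositive, but not below
  \<open>- \<tau>\<close>, for slopes within \<open>r\<close> of \<open>p\<close>, and of order \<open>norm (q - p)\<close> far away.
\<close>

lemma strict_convexity_SC_local_gap:
  fixes L :: "real \<Rightarrow> 'a::euclidean_space \<Rightarrow> 'a \<Rightarrow> real"
  assumes contL: "continuous_on ({a..b} \<times> UNIV \<times> UNIV) (\<lambda>(t, y, p). L t y p)"
    and SC: "strict_convexity_SC a b L" and t: "t \<in> {a..b}" and \<rho>: "\<rho> > 0"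
  obtains r \<tau> \<xi> \<delta> where "0 < r" "r \<le> \<rho>" "0 < \<tau>" "0 < \<delta>"
    "\<And>s y q. s \<in> {a..b} \<Longrightarrow> \<bar>s - t\<bar> \<le> \<delta> \<Longrightarrow> norm (y - y0) \<le> \<delta> \<Longrightarrow>
       L s y q \<ge> L t y0 p + \<xi> \<bullet> (q - p) - \<tau> / 4 + \<tau> * (norm (q - p) / r - 1)"
    "\<And>s y q. s \<in> {a..b} \<Longrightarrow> \<bar>s - t\<bar> \<le> \<delta> \<Longrightarrow> norm (y - y0) \<le> \<delta> \<Longrightarrow> norm (q - p) \<le> \<delta> \<Longrightarrow>
       L s y q \<le> L t y0 p + \<tau> / 4"
proof -
  \<comment> \<open>\<open>R\<close> is large enough for the point \<open>(t, y0, p)\<close> and makes \<open>r = 1/R\<close> at most \<open>\<rho>\<close>.\<close>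
  define R where "R = Max {1, 1 / \<rho>, \<bar>t\<bar>, norm y0, norm p}"
  have R: "R \<ge> 1" "R \<ge> 1 / \<rho>" "R \<ge> \<bar>t\<bar>" "R \<ge> norm y0" "R \<ge> norm p"
    unfolding R_def by (rule Max_ge; simp)+
  define r where "r = inverse R"
  have r: "0 < r" "r \<le> 1" "r \<le> \<rho>"
    using R(1,2) \<rho> by (auto simp: r_def field_simps)
  obtain \<tau> where \<tau>: "\<tau> > 0" and sg: "\<And>t y p. t \<in> {a..b} \<Longrightarrow> Max {\<bar>t\<bar>, norm y, norm p} \<le> R + 1 \<Longrightarrow>
        (\<exists>\<xi>. subgradient (L t y) p \<xi> \<and>
             (\<forall>q. norm (q - p) \<ge> inverse R \<longrightarrow> L t y q \<ge> L t y p + \<xi> \<bullet> (q - p) + 2 * \<tau>))"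
    using SC R(1) unfolding strict_convexity_SC_def by metis
  have "Max {\<bar>t\<bar>, norm y0, norm p} \<le> R + 1" using R by auto
  from sg[OF t this] obtain \<xi> where \<xi>: "\<And>q. L t y0 q \<ge> L t y0 p + \<xi> \<bullet> (q - p)"
    "\<And>q. norm (q - p) \<ge> r \<Longrightarrow> L t y0 q \<ge> L t y0 p + \<xi> \<bullet> (q - p) + 2 * \<tau>"
    unfolding subgradient_def r_def by blast
  let ?f = "\<lambda>(t, y, p). L t y p"
  let ?S = "{a..b} \<times> cball y0 1 \<times> cball p 1"
  have "continuous_on ?S ?f" using contL by (rule continuous_on_subset) auto
  then have "uniformly_continuous_on ?S ?f"
    by (intro compact_uniformly_continuous compact_Times) auto
  then obtain \<delta>0 where \<delta>0: "\<delta>0 > 0" "\<And>x x'. x \<in> ?S \<Longrightarrow> x' \<in> ?S \<Longrightarrow> dist x' x < \<delta>0 \<Longrightarrow> dist (?f x') (?f x) < \<tau> / 4"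
    unfolding uniformly_continuous_on_def using \<tau> by (metis zero_less_divide_iff zero_less_numeral)
  define \<delta> where "\<delta> = min 1 (\<delta>0 / 4)"
  have \<delta>: "\<delta> > 0" "\<delta> \<le> 1" "4 * \<delta> \<le> \<delta>0" using \<delta>0(1) by (auto simp: \<delta>_def)
  have close: "\<bar>L s y q - L t y0 q'\<bar> < \<tau> / 4"
    if "s \<in> {a..b}" "\<bar>s - t\<bar> \<le> \<delta>" "norm (y - y0) \<le> \<delta>" "norm (q - p) \<le> 1" "norm (q' - p) \<le> 1" "norm (q - q') \<le> \<delta>"
    for s y q q'
  proof -
    have "dist (s, y, q) (t, y0, q') \<le> norm (s - t) + norm (y - y0, q - q')"
      unfolding dist_norm using norm_Pair_le[of "s - t" "(y - y0, q - q')"] by simp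
    also have "norm (y - y0, q - q') \<le> norm (y - y0) + norm (q - q')" by (rule norm_Pair_le)
    finally have "dist (s, y, q) (t, y0, q') < \<delta>0" using that \<delta> by simp
    then show ?thesis
      using \<delta>0(2)[of "(t, y0, q')" "(s, y, q)"] that t \<delta>
      by (auto simp: dist_norm norm_minus_commute)
  qed
  show thesis
  proof (rule that[of r \<tau> \<delta> \<xi>])
    fix s y q assume s: "s \<in> {a..b}" "\<bar>s - t\<bar> \<le> \<delta>" "norm (y - y0) \<le> \<delta>"
    have close': "\<bar>L s y q - L t y0 q\<bar> < \<tau> / 4" if "norm (q - p) \<le> r" for q
      using close[OF s, of q q] that r \<delta> by simp
    show "L s y q \<ge> L t y0 p + \<xi> \<bullet> (q - p) - \<tau> / 4 + \<tau> * (norm (q - p) / r - 1)"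
    proof (rule convex_propagate_strict_gap[OF strict_convexity_SC_convex[OF SC s(1)] r(1)])
      show "L s y p \<le> L t y0 p + \<tau> / 4" using close'[of p] r unfolding abs_less_iff by simp
      show "L s y q \<ge> L t y0 p + \<xi> \<bullet> (q - p) - \<tau> / 4" if "norm (q - p) \<le> r" for q
        using close'[OF that] \<xi>(1)[of q] by linarith
      show "L s y q \<ge> L t y0 p + \<xi> \<bullet> (q - p) + 2 * \<tau> - \<tau> / 4" if "norm (q - p) = r" for q
        using close'[of q] \<xi>(2)[of q] that by linarith
    qed (use \<tau> in auto)
    show "L s y q \<le> L t y0 p + \<tau> / 4" if "norm (q - p) \<le> \<delta>"
      using close[OF s, of q p] that \<delta> unfolding abs_less_iff by simp
  qed (use r \<tau> \<delta> in auto)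
qed

section \<open>Minimizers have no corners\<close>

text \<open>
  Suppose that the one-sided derivatives differ by \<open>D = norm (pp - pm) > 0\<close>, let \<open>p\<close> be their mean
  and let \<open>M = L t (v t) p\<close>. On \<open>{t-h..t+h}\<close> the chord has a slope close to \<open>p\<close>, so its energy is at most
  about \<open>2 * h * M\<close>. The derivative of \<open>v\<close> has nearly the same mean, so \<open>\<xi>\<close> contributes little,
  but it has average \<open>pm\<close> on the left half and \<open>pp\<close> on the right half. Hence the integral of its
  distance from \<open>p\<close> is at least about \<open>h * D\<close>, and the linear gap makes the energy of \<open>v\<close> larger
  than that of the chord by a multiple of \<open>h * \<tau>\<close>.
\<close>

lemma minimizer_one_sided_derivatives_agree:
  fixes L :: "real \<Rightarrow> 'a::euclidean_space \<Rightarrow> 'a \<Rightarrow> real"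
  assumes contL: "continuous_on ({a..b} \<times> UNIV \<times> UNIV) (\<lambda>(t, y, p). L t y p)"
    and SC: "strict_convexity_SC a b L" and min: "is_minimizer a b L v" and t: "t \<in> {a<..<b}"
    and left: "((\<lambda>s. (v s - v t) /\<^sub>R (s - t)) \<longlongrightarrow> pm) (at_left t)"
    and right: "((\<lambda>s. (v s - v t) /\<^sub>R (s - t)) \<longlongrightarrow> pp) (at_right t)"
  shows "pm = pp"
proof (rule ccontr)
  assume "pm \<noteq> pp"
  define D where "D = norm (pp - pm)"
  have D: "D > 0" using \<open>pm \<noteq> pp\<close> by (simp add: D_def)
  define p where "p = (1/2) *\<^sub>R (pp + pm)"
  have pD: "norm (pp - p) = D / 2" "norm (pm - p) = D / 2"
  proof -
    have "pp - p = (1/2) *\<^sub>R (pp - pm)" "pm - p = - ((1/2) *\<^sub>R (pp - pm))"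
      by (simp_all add: p_def algebra_simps flip: scaleR_add_left)
    then show "norm (pp - p) = D / 2" "norm (pm - p) = D / 2" by (simp_all add: D_def)
  qed
  define M where "M = L t (v t) p"
  \<comment> \<open>With \<open>r \<le> D/8\<close> and \<open>\<eta> \<le> D/8\<close> the gap term contributes at least \<open>6 * h * \<tau>\<close>,
    against losses of at most \<open>4 * h * \<tau>\<close>.\<close>
  obtain r \<tau> \<xi> \<delta> where r: "0 < r" "r \<le> D / 8" and \<tau>: "0 < \<tau>" and \<delta>: "0 < \<delta>" and
    low: "\<And>s y q. s \<in> {a..b} \<Longrightarrow> \<bar>s - t\<bar> \<le> \<delta> \<Longrightarrow> norm (y - v t) \<le> \<delta> \<Longrightarrow>
       L s y q \<ge> M + \<xi> \<bullet> (q - p) - \<tau> / 4 + \<tau> * (norm (q - p) / r - 1)" and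
    up: "\<And>s y q. s \<in> {a..b} \<Longrightarrow> \<bar>s - t\<bar> \<le> \<delta> \<Longrightarrow> norm (y - v t) \<le> \<delta> \<Longrightarrow> norm (q - p) \<le> \<delta> \<Longrightarrow>
       L s y q \<le> M + \<tau> / 4"
    using strict_convexity_SC_local_gap[OF contL SC, of t "D / 8" "v t" p] t D unfolding M_def
    by (metis atLeastAtMost_iff greaterThanLessThan_iff less_imp_le divide_pos_pos zero_less_numeral)
  \<comment> \<open>The error allowed in the difference quotients; the last bound controls the term with \<open>\<xi>\<close>.\<close>
  define \<eta> where "\<eta> = min (D / 8) (min \<delta> (\<tau> / (2 * (norm \<xi> + 1))))"
  have n1: "norm \<xi> + 1 > 0" by (simp add: add_nonneg_pos)
  have \<eta>: "\<eta> > 0" "\<eta> \<le> D / 8" "\<eta> \<le> \<delta>" "\<eta> \<le> \<tau> / (2 * (norm \<xi> + 1))"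
    using D \<delta> \<tau> n1 unfolding \<eta>_def by (simp, linarith+)
  have \<xi>\<eta>: "norm \<xi> * \<eta> \<le> \<tau> / 2"
  proof -
    have "(norm \<xi> + 1) * \<eta> \<le> \<tau> / 2"
      using \<eta>(4) n1 by (simp add: field_simps)
    then show ?thesis using \<eta>(1) by (simp add: distrib_right)
  qed
  have vW: "v \<in> W11 a b" using min by (simp add: is_minimizer_def admissible_def)
  note W = W11_weak_derivative[OF vW]
  let ?g = "weak_derivative a b v"
  have FTC: "v y - v x = integral {x..y} ?g" if "a \<le> x" "x \<le> y" "y \<le> b" for x y
    by (rule weak_derivative_FTC[OF W(3,1) that])
  have conv: "convex_on UNIV (L s y)" if "s \<in> {a..b}" for s y
    by (rule strict_convexity_SC_convex[OF SC that])
  obtain b1 where b1: "b1 > t" "\<And>s. t < s \<Longrightarrow> s < b1 \<Longrightarrow> dist ((v s - v t) /\<^sub>R (s - t)) pp < \<eta>"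
    using tendstoD[OF right \<eta>(1)] by (auto simp: eventually_at_right_field)
  obtain b2 where b2: "b2 < t" "\<And>s. b2 < s \<Longrightarrow> s < t \<Longrightarrow> dist ((v s - v t) /\<^sub>R (s - t)) pm < \<eta>"
    using tendstoD[OF left \<eta>(1)] by (auto simp: eventually_at_left_field)
  have "isCont v t" using continuous_on_interior[OF W(2)] t by auto
  then obtain b3 where b3: "b3 > 0" "\<And>s. dist s t < b3 \<Longrightarrow> dist (v s) (v t) < \<delta>"
    using \<delta> unfolding continuous_at_eps_delta by metis
  have "\<exists>h>0. h < min (min (b1 - t) (t - b2)) b3 \<and> h < min \<delta> (min (t - a) (b - t))"
    using field_lbound_gt_zero[of "min (min (b1 - t) (t - b2)) b3" "min \<delta> (min (t - a) (b - t))"] b1 b2 b3 \<delta> t by auto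
  then obtain h where h: "h > 0" "t + h < b1" "b2 < t - h" "h < b3" "h < \<delta>" "a < t - h" "t + h < b"
    by (auto simp: less_diff_eq)
  define c where "c = t - h"
  define d where "d = t + h"
  have cd: "a \<le> c" "c < t" "t < d" "d \<le> b" "d - c = 2 * h" "d - t = h" "t - c = h"
    using h by (auto simp: c_def d_def)
  define qr where "qr = (v d - v t) /\<^sub>R h"
  define ql where "ql = (v t - v c) /\<^sub>R h"
  have qr: "norm (qr - pp) < \<eta>"
    using b1(2)[of d] h by (simp add: qr_def d_def dist_norm)
  have ql: "norm (ql - pm) < \<eta>"
  proof -
    have "(v c - v t) /\<^sub>R (c - t) = ql"
      by (simp add: ql_def c_def scaleR_diff_right)
    then show ?thesis using b2(2)[of c] h by (simp add: c_def dist_norm)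
  qed
  have vd: "v d - v t = h *\<^sub>R qr" and vc: "v t - v c = h *\<^sub>R ql"
    using h by (simp_all add: qr_def ql_def)
  define ph where "ph = (v d - v c) /\<^sub>R (d - c)"
  have php: "ph - p = (1/2) *\<^sub>R ((qr - pp) + (ql - pm))"
  proof -
    have "v d - v c = h *\<^sub>R (qr + ql)" using vd vc by (simp add: algebra_simps)
    then have "ph = (1/2) *\<^sub>R (qr + ql)" using h by (simp add: ph_def cd)
    then show ?thesis by (simp add: p_def algebra_simps)
  qed
  have ph: "norm (ph - p) \<le> \<eta>"
  proof -
    have "norm ((qr - pp) + (ql - pm)) \<le> \<eta> + \<eta>"
      using qr ql by (intro order.trans[OF norm_triangle_ineq] add_mono) auto
    then show ?thesis unfolding php by simp
  qed
  have near_v: "norm (v s - v t) \<le> \<delta>" if "s \<in> {c..d}" for s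
  proof -
    have "dist s t < b3" using that h by (auto simp: c_def d_def dist_real_def)
    from b3(2)[OF this] show ?thesis by (simp add: dist_norm)
  qed
  have near_s: "\<bar>s - t\<bar> \<le> \<delta>" "s \<in> {a..b}" if "s \<in> {c..d}" for s
    using that h cd by (auto simp: c_def d_def)
  \<comment> \<open>The chord stays near \<open>v t\<close> since its end points do and balls are convex.\<close>
  have near_w: "norm (v c + (s - c) *\<^sub>R ph - v t) \<le> \<delta>" if s: "s \<in> {c..d}" for s
  proof -
    define \<theta> where "\<theta> = (s - c) / (d - c)"
    have \<theta>: "0 \<le> \<theta>" "\<theta> \<le> 1" using s cd by (auto simp: \<theta>_def divide_le_eq)
    have "(s - c) *\<^sub>R ph = \<theta> *\<^sub>R (v d - v c)" by (simp add: ph_def \<theta>_def divide_inverse)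
    then have "v c + (s - c) *\<^sub>R ph = (1 - \<theta>) *\<^sub>R v c + \<theta> *\<^sub>R v d" by (simp add: algebra_simps)
    moreover have "(1 - \<theta>) *\<^sub>R v c + \<theta> *\<^sub>R v d \<in> cball (v t) \<delta>"
      using near_v[of c] near_v[of d] cd \<theta>
      by (intro convexD[OF convex_cball]) (auto simp: dist_norm norm_minus_commute)
    ultimately show ?thesis by (simp add: dist_norm norm_minus_commute)
  qed
  define F where "F s = L s (v s) (?g s)" for s
  define G where "G s = L s (v c + (s - c) *\<^sub>R ph) ph" for s
  have FG: "integral {c..d} F \<le> integral {c..d} G"
    unfolding F_def[abs_def] G_def[abs_def] ph_def
    by (rule minimizer_beats_chord[OF contL conv min]) (use cd in auto)
  have "F absolutely_integrable_on {a..b}"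
    unfolding F_def[abs_def]
    by (rule finite_energy_integrable[OF contL conv vW minimizer_finite_energy[OF contL min]]) (use cd in auto)
  then have "F absolutely_integrable_on {c..d}"
    by (rule absolutely_integrable_on_subinterval) (use cd in auto)
  then have F: "F integrable_on {c..d}" by (rule set_lebesgue_integral_eq_integral(1))
  have "continuous_on {c..d} (\<lambda>s. (\<lambda>(t, y, p). L t y p) (s, v c + (s - c) *\<^sub>R ph, ph))"
    by (rule continuous_on_compose2[OF contL]) (use cd in \<open>auto intro!: continuous_intros\<close>)
  then have G: "G integrable_on {c..d}"
    unfolding G_def[abs_def] by (intro integrable_continuous_real) simp
  have "integral {c..d} G \<le> integral {c..d} (\<lambda>_. M + \<tau> / 4)"
    by (rule integral_le[OF G]) (use near_s near_w ph \<eta>(3) in \<open>auto simp: G_def intro!: up\<close>)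
  then have Gle: "integral {c..d} G \<le> 2 * h * (M + \<tau> / 4)" using cd by simp
  define k where "k s = ?g s - p" for s
  \<comment> \<open>\<open>k\<close> measures how far the derivative of \<open>v\<close> deviates from \<open>p\<close>.\<close>
  have k: "k absolutely_integrable_on {x..y}" if "a \<le> x" "y \<le> b" for x y
    unfolding k_def[abs_def] using that
    by (intro set_integral_diff absolutely_integrable_on_subinterval[OF W(4)]) auto
  have ik: "integral {x..y} k = v y - v x - (y - x) *\<^sub>R p" if "a \<le> x" "x \<le> y" "y \<le> b" for x y
    unfolding k_def[abs_def] using that FTC[OF that] absolutely_integrable_on_subinterval[OF W(4), of x y]
    by (subst Henstock_Kurzweil_Integration.integral_diff) (auto simp: set_lebesgue_integral_eq_integral(1))
  have k': "k integrable_on {x..y}" "(\<lambda>s. norm (k s)) integrable_on {x..y}" if "a \<le> x" "y \<le> b" for x y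
    using k[OF that] by (auto simp: absolutely_integrable_on_def)
  define N where "N = integral {c..d} (\<lambda>s. norm (k s))"
  \<comment> \<open>Splitting at the corner prevents the two deviations from cancelling.\<close>
  have Nsplit: "N = integral {c..t} (\<lambda>s. norm (k s)) + integral {t..d} (\<lambda>s. norm (k s))"
    unfolding N_def using cd k'
    by (intro Henstock_Kurzweil_Integration.integral_combine[symmetric]) auto
  have N1: "norm (integral {c..t} k) + norm (integral {t..d} k) \<le> N"
    unfolding Nsplit using cd k' by (intro add_mono integral_norm_bound_integral) auto
  have "integral {c..t} k = h *\<^sub>R (ql - p)" "integral {t..d} k = h *\<^sub>R (qr - p)"
    using ik[of c t] ik[of t d] cd vd vc by (auto simp: algebra_simps)
  moreover have "norm (ql - p) \<ge> D / 2 - \<eta>"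
    using norm_triangle_ineq[of "pm - ql" "ql - p"] ql pD by (simp add: norm_minus_commute)
  moreover have "norm (qr - p) \<ge> D / 2 - \<eta>"
    using norm_triangle_ineq[of "pp - qr" "qr - p"] qr pD by (simp add: norm_minus_commute)
  ultimately have "h * (D / 2 - \<eta>) + h * (D / 2 - \<eta>) \<le> norm (integral {c..t} k) + norm (integral {t..d} k)"
    using h by (simp only: norm_scaleR) (intro add_mono mult_left_mono, auto)
  then have "h * (D - 2 * \<eta>) \<le> N" using N1 by (simp add: algebra_simps)
  moreover have "h * (6 * r) \<le> h * (D - 2 * \<eta>)"
    using h r \<eta> by (intro mult_left_mono) auto
  ultimately have N: "6 * h \<le> N / r" using r by (simp add: field_simps)
  have lowint: "((\<lambda>s. (M - \<tau> / 4 - \<tau>) + \<xi> \<bullet> k s + (\<tau> / r) * norm (k s)) has_integral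
      (2 * h * (M - \<tau> / 4 - \<tau>) + \<xi> \<bullet> integral {c..d} k + (\<tau> / r) * N)) {c..d}"
  proof (intro has_integral_add)
    show "((\<lambda>s. M - \<tau> / 4 - \<tau>) has_integral 2 * h * (M - \<tau> / 4 - \<tau>)) {c..d}"
      using has_integral_const_real[of "M - \<tau> / 4 - \<tau>" c d] cd by simp
    show "((\<lambda>s. \<xi> \<bullet> k s) has_integral \<xi> \<bullet> integral {c..d} k) {c..d}"
      using has_integral_linear[OF integrable_integral[OF k'(1)[of c d]] bounded_linear_inner_right[of \<xi>]] cd
      by (simp add: o_def)
    show "((\<lambda>s. \<tau> / r * norm (k s)) has_integral \<tau> / r * N) {c..d}"
      unfolding N_def using cd by (intro has_integral_mult_right integrable_integral k')
  qed
  have "2 * h * (M - \<tau> / 4 - \<tau>) + \<xi> \<bullet> integral {c..d} k + (\<tau> / r) * N \<le> integral {c..d} F"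
  proof (rule has_integral_le[OF lowint integrable_integral[OF F]])
    fix s assume s: "s \<in> {c..d}"
    have "L s (v s) (?g s) \<ge> M + \<xi> \<bullet> (?g s - p) - \<tau> / 4 + \<tau> * (norm (?g s - p) / r - 1)"
      by (intro low near_s near_v s)
    then show "(M - \<tau> / 4 - \<tau>) + \<xi> \<bullet> k s + (\<tau> / r) * norm (k s) \<le> F s"
      by (simp add: F_def k_def right_diff_distrib)
  qed
  moreover have "\<xi> \<bullet> integral {c..d} k \<ge> - (2 * h * (\<tau> / 2))"
  proof -
    have "integral {c..d} k = (2 * h) *\<^sub>R (ph - p)"
      using ik[of c d] cd h by (simp add: ph_def algebra_simps)
    moreover have "\<bar>\<xi> \<bullet> (ph - p)\<bar> \<le> norm \<xi> * \<eta>"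
      using Cauchy_Schwarz_ineq2[of \<xi> "ph - p"] mult_left_mono[OF ph norm_ge_zero[of \<xi>]] by linarith
    then have "\<xi> \<bullet> (ph - p) \<ge> - (\<tau> / 2)" using \<xi>\<eta> by linarith
    then have "2 * h * (\<xi> \<bullet> (ph - p)) \<ge> 2 * h * (- (\<tau> / 2))"
      using h by (intro mult_left_mono) auto
    ultimately show ?thesis by simp
  qed
  moreover have "(\<tau> / r) * N \<ge> \<tau> * (6 * h)"
    using mult_left_mono[OF N, of \<tau>] \<tau> by simp
  ultimately have "2 * h * (M - \<tau> / 4 - \<tau>) - 2 * h * (\<tau> / 2) + \<tau> * (6 * h) \<le> 2 * h * (M + \<tau> / 4)"
    using FG Gle by linarith
  then have "2 * (h * \<tau>) \<le> 0" by (simp add: algebra_simps)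
  then show False using mult_pos_pos[OF h(1) \<tau>] by linarith
qed

text \<open>
  Finite extended one-sided derivatives are limits of the real difference quotients in each
  component, hence of the vector-valued ones.
\<close>

theorem corollary26:
  fixes a b t :: real
    and L :: "real \<Rightarrow> real ^ 'n \<Rightarrow> real ^ 'n \<Rightarrow> real"
    and v :: "real \<Rightarrow> real ^ 'n"
    and Dminus Dplus :: "ereal ^ 'n"
  assumes "continuous_on ({a..b} \<times> UNIV \<times> UNIV) (\<lambda>(t, y, p). L t y p)"
    and "strict_convexity_SC a b L"
    and "v \<in> W11 a b"
    and "is_minimizer a b L v"
    and "t \<in> {a<..<b}"
    and "has_left_derivative v t Dminus"
    and "has_right_derivative v t Dplus"
    and "\<forall>i. \<bar>Dminus $ i\<bar> \<noteq> \<infinity> \<and> \<bar>Dplus $ i\<bar> \<noteq> \<infinity>"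
  shows "Dminus = Dplus"
proof -
  define pm :: "real ^ 'n" where "pm = (\<chi> i. real_of_ereal (Dminus $ i))"
  define pp :: "real ^ 'n" where "pp = (\<chi> i. real_of_ereal (Dplus $ i))"
  have D: "Dminus $ i = ereal (pm $ i)" "Dplus $ i = ereal (pp $ i)" for i
    using assms(8) by (auto simp: pm_def pp_def ereal_real)
  have "((\<lambda>s. (v s - v t) /\<^sub>R (s - t)) \<longlongrightarrow> pm) (at_left t)"
    using assms(6) unfolding has_left_derivative_def D
    by (intro vec_tendstoI) (simp add: divide_inverse mult.commute)
  moreover have "((\<lambda>s. (v s - v t) /\<^sub>R (s - t)) \<longlongrightarrow> pp) (at_right t)"
    using assms(7) unfolding has_right_derivative_def D
    by (intro vec_tendstoI) (simp add: divide_inverse mult.commute)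
  ultimately have "pm = pp"
    using minimizer_one_sided_derivatives_agree[OF assms(1,2,4,5)] by blast
  then show ?thesis using D by (simp add: vec_eq_iff)
qed

end
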